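(* Over ZF, each of the following two conditions is equivalent to the axiom of choice: (1) For every infinite cardinal $\mathfrak{m}$ we have $[\mathfrak{m}]^2=\mathfrak{m}$. (2) For every infinite cardinal $\mathfrak{m}$ we have $[\mathfrak{m}]^2=\mathfrak{m}$ or $\mathfrak{m}^2=\mathfrak{m}$.
   Context: The base theory is ZF (no axiom of choice). The cardinality $\mathfrak{m}$ of a set $m$ is its equinumerosity class (represented as a set by Scott's trick), so two sets have the same cardinality iff there is a bijection between them; cardinals need not be alephs. A cardinal is infinite if it is not the cardinality of a natural number. For a set $m$ of cardinality $\mathfrak{m}$: $[\mathfrak{m}]^2$ denotes the cardinality of the set $[m]^2$ of all $2$-element subsets of $m$, and $\mathfrak{m}^2=\mathfrak{m}\cdot\mathfrak{m}$ denotes the cardinality of $m\times m$. *)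

theory Defs
  imports Main
begin

text \<open>
  HOL itself has a choice operator, so ZF is not identified with the sets of HOL.  Instead,
  ``over ZF'' is read as ``in every model of first-order ZF''.  A structure for the language
  of set theory is a binary relation \<open>E\<close> on a type, \<open>E x y\<close> meaning that \<open>x\<close> is an element of
  \<open>y\<close>; the individuals of the type are the sets of the structure.  Separation and Replacement
  are first-order schemes: they range over formulas with parameters, not over arbitrary HOL
  predicates.  (With arbitrary HOL predicates, the choice operator would force the axiom of
  choice in every model.)
\<close>

section \<open>First-order formulas of set theory\<close>

datatype fm =
    Mem nat nat
  | Equal nat nat
  | Neg fm
  | Conj fm fm
  | Forall nat fm

primrec sat :: "('a \<Rightarrow> 'a \<Rightarrow> bool) \<Rightarrow> (nat \<Rightarrow> 'a) \<Rightarrow> fm \<Rightarrow> bool" where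
  "sat E s (Mem i j) \<longleftrightarrow> E (s i) (s j)"
| "sat E s (Equal i j) \<longleftrightarrow> s i = s j"
| "sat E s (Neg \<phi>) \<longleftrightarrow> \<not> sat E s \<phi>"
| "sat E s (Conj \<phi> \<psi>) \<longleftrightarrow> sat E s \<phi> \<and> sat E s \<psi>"
| "sat E s (Forall i \<phi>) \<longleftrightarrow> (\<forall>a. sat E (s(i := a)) \<phi>)"

section \<open>Set-theoretic notions inside a structure\<close>

definition is_empty_set :: "('a \<Rightarrow> 'a \<Rightarrow> bool) \<Rightarrow> 'a \<Rightarrow> bool" where
  "is_empty_set E x \<longleftrightarrow> (\<forall>z. \<not> E z x)"

text \<open>The last argument is the set being described: \<open>s = x \<union> {x}\<close>, \<open>p = {a, b}\<close>,
  \<open>p = {{a}, {a, b}}\<close>, \<open>p = [m]\<^sup>2\<close> and \<open>p = m \<times> n\<close>, respectively.\<close>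

definition is_succ :: "('a \<Rightarrow> 'a \<Rightarrow> bool) \<Rightarrow> 'a \<Rightarrow> 'a \<Rightarrow> bool" where
  "is_succ E x s \<longleftrightarrow> (\<forall>z. E z s \<longleftrightarrow> E z x \<or> z = x)"

definition is_upair :: "('a \<Rightarrow> 'a \<Rightarrow> bool) \<Rightarrow> 'a \<Rightarrow> 'a \<Rightarrow> 'a \<Rightarrow> bool" where
  "is_upair E a b p \<longleftrightarrow> (\<forall>z. E z p \<longleftrightarrow> z = a \<or> z = b)"

definition is_opair :: "('a \<Rightarrow> 'a \<Rightarrow> bool) \<Rightarrow> 'a \<Rightarrow> 'a \<Rightarrow> 'a \<Rightarrow> bool" where
  "is_opair E a b p \<longleftrightarrow> (\<exists>s d. is_upair E a a s \<and> is_upair E a b d \<and> is_upair E s d p)"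

definition is_two_subsets :: "('a \<Rightarrow> 'a \<Rightarrow> bool) \<Rightarrow> 'a \<Rightarrow> 'a \<Rightarrow> bool" where
  "is_two_subsets E m p \<longleftrightarrow>
     (\<forall>z. E z p \<longleftrightarrow> (\<exists>a b. E a m \<and> E b m \<and> a \<noteq> b \<and> is_upair E a b z))"

definition is_product :: "('a \<Rightarrow> 'a \<Rightarrow> bool) \<Rightarrow> 'a \<Rightarrow> 'a \<Rightarrow> 'a \<Rightarrow> bool" where
  "is_product E m n p \<longleftrightarrow> (\<forall>z. E z p \<longleftrightarrow> (\<exists>a b. E a m \<and> E b n \<and> is_opair E a b z))"

text \<open>The pair \<open>(a, b)\<close> is an element of the set \<open>f\<close>.\<close>

definition maps :: "('a \<Rightarrow> 'a \<Rightarrow> bool) \<Rightarrow> 'a \<Rightarrow> 'a \<Rightarrow> 'a \<Rightarrow> bool" where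
  "maps E f a b \<longleftrightarrow> (\<exists>p. is_opair E a b p \<and> E p f)"

definition is_bijection :: "('a \<Rightarrow> 'a \<Rightarrow> bool) \<Rightarrow> 'a \<Rightarrow> 'a \<Rightarrow> 'a \<Rightarrow> bool" where
  "is_bijection E f x y \<longleftrightarrow>
     (\<forall>p. E p f \<longrightarrow> (\<exists>a b. E a x \<and> E b y \<and> is_opair E a b p)) \<and>
     (\<forall>a. E a x \<longrightarrow> (\<exists>!b. maps E f a b)) \<and>
     (\<forall>b. E b y \<longrightarrow> (\<exists>!a. maps E f a b))"

definition is_inductive :: "('a \<Rightarrow> 'a \<Rightarrow> bool) \<Rightarrow> 'a \<Rightarrow> bool" where
  "is_inductive E I \<longleftrightarrow>
     (\<exists>e. is_empty_set E e \<and> E e I) \<and>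
     (\<forall>x. E x I \<longrightarrow> (\<exists>s. is_succ E x s \<and> E s I))"

text \<open>The natural numbers in the sense of the structure, i.e. the elements of its \<open>\<omega>\<close>.\<close>

definition is_natural :: "('a \<Rightarrow> 'a \<Rightarrow> bool) \<Rightarrow> 'a \<Rightarrow> bool" where
  "is_natural E n \<longleftrightarrow> (\<forall>I. is_inductive E I \<longrightarrow> E n I)"

section \<open>Models of ZF and the axiom of choice\<close>

text \<open>In the two schemes the assignment \<open>s\<close> supplies the parameters; variable \<open>0\<close> (and, for
  Replacement, variable \<open>1\<close>) is the distinguished variable of the formula.\<close>

locale ZF_model =
  fixes E :: "'a \<Rightarrow> 'a \<Rightarrow> bool"
  assumes extensionality: "(\<forall>z. E z x \<longleftrightarrow> E z y) \<Longrightarrow> x = y"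
    and foundation: "(\<exists>y. E y x) \<Longrightarrow> \<exists>y. E y x \<and> (\<forall>z. E z x \<longrightarrow> \<not> E z y)"
    and pairing: "\<exists>p. is_upair E a b p"
    and union: "\<exists>u. \<forall>z. E z u \<longleftrightarrow> (\<exists>y. E y x \<and> E z y)"
    and power_set: "\<exists>p. \<forall>y. E y p \<longleftrightarrow> (\<forall>z. E z y \<longrightarrow> E z x)"
    and infinity: "\<exists>I. is_inductive E I"
    and separation: "\<exists>v. \<forall>z. E z v \<longleftrightarrow> E z u \<and> sat E (s(0 := z)) \<phi>"
    and replacement:
      "(\<forall>x y y'. E x u \<and> sat E (s(0 := x, 1 := y)) \<phi> \<and> sat E (s(0 := x, 1 := y')) \<phi>
          \<longrightarrow> y = y') \<Longrightarrow>
       \<exists>v. \<forall>y. E y v \<longleftrightarrow> (\<exists>x. E x u \<and> sat E (s(0 := x, 1 := y)) \<phi>)"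

text \<open>Every set of nonempty sets has a choice function.\<close>

definition axiom_of_choice :: "('a \<Rightarrow> 'a \<Rightarrow> bool) \<Rightarrow> bool" where
  "axiom_of_choice E \<longleftrightarrow>
     (\<forall>x. (\<forall>y. E y x \<longrightarrow> (\<exists>z. E z y)) \<longrightarrow>
        (\<exists>f. (\<forall>p. E p f \<longrightarrow> (\<exists>y z. E y x \<and> E z y \<and> is_opair E y z p)) \<and>
             (\<forall>y. E y x \<longrightarrow> (\<exists>!z. maps E f y z))))"

section \<open>Cardinals inside a structure\<close>

definition equinumerous :: "('a \<Rightarrow> 'a \<Rightarrow> bool) \<Rightarrow> 'a \<Rightarrow> 'a \<Rightarrow> bool" where
  "equinumerous E x y \<longleftrightarrow> (\<exists>f. is_bijection E f x y)"

text \<open>The cardinality of a set is its equinumerosity class.  A class of the structure is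
  available as a HOL set of individuals, so Scott's trick for coding it by a set of the
  structure is not needed.\<close>

definition cardinality :: "('a \<Rightarrow> 'a \<Rightarrow> bool) \<Rightarrow> 'a \<Rightarrow> 'a set" where
  "cardinality E x = {y. equinumerous E y x}"

definition is_cardinal :: "('a \<Rightarrow> 'a \<Rightarrow> bool) \<Rightarrow> 'a set \<Rightarrow> bool" where
  "is_cardinal E \<mm> \<longleftrightarrow> (\<exists>m. \<mm> = cardinality E m)"

definition infinite_cardinal :: "('a \<Rightarrow> 'a \<Rightarrow> bool) \<Rightarrow> 'a set \<Rightarrow> bool" where
  "infinite_cardinal E \<mm> \<longleftrightarrow>
     is_cardinal E \<mm> \<and> \<not> (\<exists>n. is_natural E n \<and> \<mm> = cardinality E n)"

text \<open>\<open>[\<mm>]\<^sup>2\<close> and \<open>\<mm> \<cdot> \<nn>\<close>.  In a model of ZF the sets \<open>[m]\<^sup>2\<close> and \<open>m \<times> n\<close> exist and their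
  cardinalities do not depend on the representatives, so each union below is the union of a
  single equinumerosity class.\<close>

definition two_subsets_cardinal :: "('a \<Rightarrow> 'a \<Rightarrow> bool) \<Rightarrow> 'a set \<Rightarrow> 'a set" where
  "two_subsets_cardinal E \<mm> = \<Union> {cardinality E p | m p. m \<in> \<mm> \<and> is_two_subsets E m p}"

definition cardinal_mult :: "('a \<Rightarrow> 'a \<Rightarrow> bool) \<Rightarrow> 'a set \<Rightarrow> 'a set \<Rightarrow> 'a set" where
  "cardinal_mult E \<mm> \<nn> =
     \<Union> {cardinality E p | m n p. m \<in> \<mm> \<and> n \<in> \<nn> \<and> is_product E m n p}"

end

theory Submission imports Defs begin

text \<open>
  Inside a model of ZF, both conditions are compared with the statement that every set injects
  into an ordinal, which is equivalent to choice (\<open>embeds_ordinal_if_choice\<close>,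
  \<open>choice_if_embeds_ordinal\<close>).

  From the conditions to choice, Tarski's argument for squares applies to both. Let \<open>A\<close> be a set
  and \<open>h\<close> an ordinal that does not inject into \<open>A\<close> (\<open>hartogs\<close>), and let \<open>n\<close> be the disjoint
  sum of \<open>A\<close> and \<open>h\<close>. A pair \<open>(a, b)\<close> in \<open>A \<times> h\<close> yields the two-element subset of \<open>n\<close>
  consisting of the copies of \<open>a\<close> and \<open>b\<close>, as well as an element of \<open>n \<times> n\<close>; so if \<open>[n]\<^sup>2\<close> or
  \<open>n \<times> n\<close> is equinumerous to \<open>n\<close>, then \<open>A \<times> h\<close> injects into the sum of \<open>A\<close> and \<open>h\<close>. No
  fibre \<open>{a} \<times> h\<close> can be mapped entirely into \<open>A\<close>, so each \<open>a\<close> has a least \<open>b\<close> for which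
  \<open>(a, b)\<close> lands in \<open>h\<close>, and sending \<open>a\<close> to the value there injects \<open>A\<close> into \<open>h\<close>
  (\<open>tarski_comparison\<close>). Enlarging \<open>A\<close> by \<open>\<omega>\<close> beforehand makes \<open>n\<close> infinite: were \<open>n\<close>
  equinumerous to a natural number \<open>k\<close>, then \<open>h\<close> would inject into \<open>k \<subseteq> \<omega> \<subseteq> A\<close>.

  From choice to \<open>[m]\<^sup>2 = m\<close>, an infinite set \<open>m\<close> is equinumerous to an ordinal \<open>k\<close> outside
  \<open>\<omega>\<close>. Goedel's well-ordering of \<open>k \<times> k\<close> shows that \<open>k \<times> k\<close> injects into \<open>k\<close>
  (\<open>hessenberg\<close>), and \<open>[k]\<^sup>2\<close> injects into \<open>k \<times> k\<close> by listing each pair in increasing order;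
  conversely \<open>k\<close> injects into \<open>[k]\<^sup>2\<close>. Two injections in opposite directions give a bijection,
  because for sets that inject into an ordinal the least such ordinal is equinumerous to the set.

  All of this has to be carried out with sets of the model, and Separation and Replacement only
  apply to first-order formulas. To argue as usual, the predicate \<open>definable\<close> singles out those
  HOL predicates on assignments that some formula with parameters expresses, and
  \<open>definable_term\<close> does the same for functions. The closure rules collected in
  \<open>definable_intros\<close> make definability checks syntax-directed. A set \<open>x\<close> of the model is then
  used through its HOL extension \<open>ext x\<close>, and injections and bijections of the model are the
  definable HOL functions that are injective or bijective on these extensions: Replacement turns
  the restriction of such a function to a set into a set of pairs.
\<close>

section \<open>Renaming the variables of a formula\<close>

primrec rename_vars :: "(nat \<Rightarrow> nat) \<Rightarrow> fm \<Rightarrow> fm" where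
  "rename_vars f (Mem i j) = Mem (f i) (f j)"
| "rename_vars f (Equal i j) = Equal (f i) (f j)"
| "rename_vars f (Neg \<phi>) = Neg (rename_vars f \<phi>)"
| "rename_vars f (Conj \<phi> \<psi>) = Conj (rename_vars f \<phi>) (rename_vars f \<psi>)"
| "rename_vars f (Forall i \<phi>) = Forall (f i) (rename_vars f \<phi>)"

text \<open>Injectivity keeps bound variables apart from free ones, so no capture can occur.\<close>

lemma sat_rename_vars:
  assumes "inj f"
  shows "sat E s (rename_vars f \<phi>) = sat E (\<lambda>i. s (f i)) \<phi>"
proof (induction \<phi> arbitrary: s)
  case (Forall i \<phi>)
  have "(\<lambda>j. (s(f i := a)) (f j)) = (\<lambda>j. s (f j))(i := a)" for a
    using assms by (auto simp: fun_eq_iff inj_def)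
  then show ?case using Forall by simp
qed auto

text \<open>An assignment in which the even positions hold the free variables and the odd positions
  the parameters; parameters can then be added without disturbing the free variables.\<close>

definition interleave :: "(nat \<Rightarrow> 'a) \<Rightarrow> (nat \<Rightarrow> 'a) \<Rightarrow> nat \<Rightarrow> 'a" where
  "interleave s p i = (if even i then s (i div 2) else p (i div 2))"

lemma interleave_even [simp]: "interleave s p (2 * i) = s i"
  by (simp add: interleave_def)

lemma interleave_odd [simp]: "interleave s p (Suc (2 * i)) = p i"
  by (simp add: interleave_def)

lemma interleave_eqI:
  assumes "\<And>i. g (2 * i) = s i" "\<And>i. g (Suc (2 * i)) = p i"
  shows "g = interleave s p"
proof
  show "g i = interleave s p i" for i
    by (cases "even i") (auto simp: assms elim!: evenE oddE)
qed

lemma interleave_comp: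
  "(\<lambda>i. h (interleave s p i)) = interleave (\<lambda>i. h (s i)) (\<lambda>i. h (p i))"
  by (rule interleave_eqI) simp_all

lemma inj_interleave:
  assumes "inj s" "inj p" "\<And>i j. s i \<noteq> p j"
  shows "inj (interleave s p)"
proof (rule injI)
  fix i j assume eq: "interleave s p i = interleave s p j"
  have parity: "\<exists>m. k = 2 * m \<or> k = Suc (2 * m)" for k :: nat
    by presburger
  obtain m n where "i = 2 * m \<or> i = Suc (2 * m)" "j = 2 * n \<or> j = Suc (2 * n)"
    using parity by metis
  then show "i = j"
    using eq assms(3)[of m n] assms(3)[of n m] injD[OF assms(1), of m n] injD[OF assms(2), of m n]
    by (elim disjE) (simp_all only: interleave_even interleave_odd simp_thms)
qed

text \<open>Definite description with one fixed value for all predicates that lack a unique witness;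
  for \<open>THE\<close> the value in that case may depend on the predicate in an undefinable way.\<close>

definition the1 :: "('a \<Rightarrow> bool) \<Rightarrow> 'a" where
  "the1 P = (if \<exists>!y. P y then THE y. P y else undefined)"

lemma the1_eqI: "P a \<Longrightarrow> (\<And>y. P y \<Longrightarrow> y = a) \<Longrightarrow> the1 P = a"
  unfolding the1_def by (subst if_P) (blast, rule the_equality)

lemma the1I: "\<exists>!y. P y \<Longrightarrow> P (the1 P)"
  unfolding the1_def by (simp add: theI')

section \<open>Definable predicates and terms\<close>

named_theorems definable_intros

context ZF_model begin

text \<open>Assignments play the role of stacks: a binder pushes its variable at index \<open>0\<close> and
  shifts all others by one. The body of \<open>\<forall>x. P x s\<close> thus becomes
  \<open>\<lambda>s. P (s 0) (\<lambda>i. s (Suc i))\<close>, a form that higher-order unification computes from the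
  goal, so that no variable names have to be chosen.\<close>

definition definable :: "((nat \<Rightarrow> 'a) \<Rightarrow> bool) \<Rightarrow> bool" where
  "definable Q \<longleftrightarrow> (\<exists>\<phi> p. \<forall>s. Q s \<longleftrightarrow> sat E (interleave s p) \<phi>)"

text \<open>A term is definable if its graph is, with the value at index \<open>0\<close>.\<close>

definition definable_term :: "((nat \<Rightarrow> 'a) \<Rightarrow> 'a) \<Rightarrow> bool" where
  "definable_term t \<longleftrightarrow> definable (\<lambda>s. s 0 = t (\<lambda>i. s (Suc i)))"

lemma definable_mem_var: "definable (\<lambda>s. E (s i) (s j))"
  unfolding definable_def
  by (rule exI[of _ "Mem (2*i) (2*j)"]) (auto simp: interleave_def)

lemma definable_eq_var: "definable (\<lambda>s. s i = s j)"
  unfolding definable_def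
  by (rule exI[of _ "Equal (2*i) (2*j)"]) (auto simp: interleave_def)

lemma definable_not [definable_intros]: "definable P \<Longrightarrow> definable (\<lambda>s. \<not> P s)"
  unfolding definable_def by (meson sat.simps(3))

lemma definable_conj [definable_intros]:
  assumes "definable P" "definable Q"
  shows "definable (\<lambda>s. P s \<and> Q s)"
proof -
  obtain \<phi> p where P: "\<And>s. P s \<longleftrightarrow> sat E (interleave s p) \<phi>"
    using assms(1) unfolding definable_def by auto
  obtain \<psi> q where Q: "\<And>s. Q s \<longleftrightarrow> sat E (interleave s q) \<psi>"
    using assms(2) unfolding definable_def by auto
  \<comment> \<open>The parameters \<open>p\<close> and \<open>q\<close> are themselves interleaved; \<open>f\<close> and \<open>g\<close> redirect each
    formula to its own half.\<close>
  define f g :: "nat \<Rightarrow> nat"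
    where "f = interleave (\<lambda>i. 2 * i) (\<lambda>i. Suc (2 * (2 * i)))"
      and "g = interleave (\<lambda>i. 2 * i) (\<lambda>i. Suc (2 * Suc (2 * i)))"
  have "inj f" "inj g"
    unfolding f_def g_def by (rule inj_interleave; (simp add: inj_def; fail)?; presburger)+
  moreover have "(\<lambda>i. interleave s (interleave p q) (f i)) = interleave s p"
    and "(\<lambda>i. interleave s (interleave p q) (g i)) = interleave s q" for s
    by (simp_all only: f_def g_def interleave_comp interleave_even interleave_odd)
  ultimately have "P s \<and> Q s \<longleftrightarrow> sat E (interleave s (interleave p q))
      (Conj (rename_vars f \<phi>) (rename_vars g \<psi>))" for s
    using P Q by (simp add: sat_rename_vars)
  then show ?thesis unfolding definable_def by blast
qed

lemma definable_reindex:
  assumes "definable Q" "inj g"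
  shows "definable (\<lambda>s. Q (\<lambda>i. s (g i)))"
proof -
  obtain \<phi> p where Q: "\<And>s. Q s \<longleftrightarrow> sat E (interleave s p) \<phi>"
    using assms(1) unfolding definable_def by auto
  define f where "f = interleave (\<lambda>i. 2 * g i) (\<lambda>i. Suc (2 * i))"
  have "inj f"
    unfolding f_def
    using \<open>inj g\<close> by (intro inj_interleave) (simp add: inj_def, simp add: inj_def, presburger)
  moreover have "(\<lambda>i. interleave s p (f i)) = interleave (\<lambda>i. s (g i)) p" for s
    by (simp only: f_def interleave_comp interleave_even interleave_odd)
  ultimately have "Q (\<lambda>i. s (g i)) \<longleftrightarrow> sat E (interleave s p) (rename_vars f \<phi>)" for s
    using Q by (simp add: sat_rename_vars)
  then show ?thesis unfolding definable_def by blast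
qed

text \<open>Weakening under the variable that is about to be bound: it stays at index \<open>0\<close> while
  all others make room for a new variable at index \<open>1\<close>.\<close>

lemma definable_skip:
  assumes "definable (\<lambda>s. P (s 0) (\<lambda>i. s (Suc i)))"
  shows "definable (\<lambda>s. P (s 0) (\<lambda>i. s (Suc (Suc i))))"
proof -
  have "inj (case_nat 0 (\<lambda>i. Suc (Suc i)))"
    by (auto simp: inj_def split: nat.splits)
  from definable_reindex[OF assms this] show ?thesis by simp
qed

text \<open>A bound variable and a fixed parameter are both handled by moving the top variable of the
  assignment into the parameter sequence, where it can be quantified or instantiated.\<close>

lemma definable_push:
  assumes "definable (\<lambda>s. P (s 0) (\<lambda>i. s (Suc i)))"
  shows "\<exists>\<phi> p. \<forall>x s. P x s \<longleftrightarrow> sat E (interleave s (case_nat x p)) \<phi>"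
proof -
  obtain \<phi> p where P: "\<And>s. P (s 0) (\<lambda>i. s (Suc i)) \<longleftrightarrow> sat E (interleave s p) \<phi>"
    using assms unfolding definable_def by auto
  define f :: "nat \<Rightarrow> nat"
    where "f = interleave (case_nat 1 (\<lambda>i. 2 * i)) (\<lambda>i. Suc (2 * Suc i))"
  have "inj f"
    unfolding f_def
    by (intro inj_interleave)
      (auto simp: inj_def split: nat.splits, presburger+)
  moreover have "(\<lambda>i. interleave s (case_nat x p) (f i)) = interleave (case_nat x s) p" for s x
  proof -
    have "interleave s (case_nat x p) (case_nat 1 (\<lambda>i. 2 * i) i) = case_nat x s i" for i
      using interleave_odd[of s "case_nat x p" 0] by (cases i) simp_all
    then show ?thesis
      by (simp only: f_def interleave_comp interleave_odd nat.case)
  qed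
  ultimately have "P x s \<longleftrightarrow> sat E (interleave s (case_nat x p)) (rename_vars f \<phi>)" for x s
    using P[of "case_nat x s"] by (simp add: sat_rename_vars)
  then show ?thesis by blast
qed

lemma definable_instance:
  assumes "definable (\<lambda>s. P (s 0) (\<lambda>i. s (Suc i)))"
  shows "definable (\<lambda>s. P c s)"
proof -
  obtain \<phi> p where "\<And>x s. P x s \<longleftrightarrow> sat E (interleave s (case_nat x p)) \<phi>"
    using definable_push[of P, OF assms] by blast
  then show ?thesis unfolding definable_def by blast
qed

lemma definable_all [definable_intros]:
  assumes "definable (\<lambda>s. P (s 0) (\<lambda>i. s (Suc i)))"
  shows "definable (\<lambda>s. \<forall>x. P x s)"
proof -
  obtain \<phi> p where P: "\<And>x s. P x s \<longleftrightarrow> sat E (interleave s (case_nat x p)) \<phi>"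
    using definable_push[of P, OF assms] by blast
  have "(interleave s (case_nat undefined p))(1 := x) = interleave s (case_nat x p)" for s x
    by (rule interleave_eqI) (auto simp: interleave_odd[of _ _ 0, simplified] split: nat.splits)
  then have "(\<forall>x. P x s) \<longleftrightarrow> sat E (interleave s (case_nat undefined p)) (Forall 1 \<phi>)" for s
    using P by simp
  then show ?thesis unfolding definable_def by blast
qed

lemma definable_disj [definable_intros]:
  assumes "definable P" "definable Q"
  shows "definable (\<lambda>s. P s \<or> Q s)"
proof -
  have "definable (\<lambda>s. \<not> (\<not> P s \<and> \<not> Q s))"
    by (intro definable_not definable_conj assms)
  then show ?thesis by simp
qed

lemma definable_imp [definable_intros]:
  assumes "definable P" "definable Q"
  shows "definable (\<lambda>s. P s \<longrightarrow> Q s)"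
proof -
  have "definable (\<lambda>s. \<not> P s \<or> Q s)"
    by (intro definable_not definable_disj assms)
  then show ?thesis by simp
qed

lemma definable_iff [definable_intros]:
  assumes "definable P" "definable Q"
  shows "definable (\<lambda>s. P s \<longleftrightarrow> Q s)"
proof -
  have "definable (\<lambda>s. (P s \<longrightarrow> Q s) \<and> (Q s \<longrightarrow> P s))"
    by (intro definable_conj definable_imp assms)
  then show ?thesis by (simp only: iff_conv_conj_imp)
qed

lemma definable_ex [definable_intros]:
  assumes "definable (\<lambda>s. P (s 0) (\<lambda>i. s (Suc i)))"
  shows "definable (\<lambda>s. \<exists>x. P x s)"
proof -
  have "definable (\<lambda>s. \<not> (\<forall>x. \<not> P x s))"
    by (intro definable_not definable_all assms)
  then show ?thesis by simp
qed

lemma definable_true [definable_intros]: "definable (\<lambda>s. b)"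
proof -
  have "definable (\<lambda>s. s 0 = s 0)" by (rule definable_eq_var)
  with definable_not[OF this] show ?thesis by (cases b) auto
qed

text \<open>Substituting a term for a variable is expressed by \<open>\<exists>x. x = t s \<and> P x s\<close>, which avoids
  substitution on formulas. The variants \<open>definable_subst1\<close> to \<open>definable_subst3\<close> lift a
  predicate known to be definable on variables to arbitrary terms.\<close>

lemma definable_subst:
  assumes "definable (\<lambda>s. P (s 0) (\<lambda>i. s (Suc i)))" "definable_term t"
  shows "definable (\<lambda>s. P (t s) s)"
proof -
  have "definable (\<lambda>s. \<exists>x. x = t s \<and> P x s)"
    using assms unfolding definable_term_def by (intro definable_intros)
  then show ?thesis by simp
qed

lemma definable_term_weaken:
  assumes "definable_term t"
  shows "definable_term (\<lambda>s. t (\<lambda>i. s (Suc i)))"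
  using definable_skip[of "\<lambda>x s. x = t s", OF assms[unfolded definable_term_def]]
  unfolding definable_term_def .

lemma definable_subst1:
  "definable (\<lambda>s. P (s 0)) \<Longrightarrow> definable_term t \<Longrightarrow> definable (\<lambda>s. P (t s))"
  by (rule definable_subst[of "\<lambda>x s. P x"])

lemma definable_subst2:
  assumes "definable (\<lambda>s. P (s 0) (s (Suc 0)))" "definable_term t" "definable_term u"
  shows "definable (\<lambda>s. P (t s) (u s))"
proof -
  have "definable (\<lambda>s. P (s (Suc 0)) (s 0))"
    using definable_reindex[OF assms(1), of "\<lambda>i. if i = 0 then 1 else if i = 1 then 0 else i"]
    by (auto simp: inj_def split: if_splits)
  then have "definable (\<lambda>s. P (s 0) (u (\<lambda>i. s (Suc i))))"
    using definable_subst[of "\<lambda>y s. P (s 0) y"] definable_term_weaken[OF assms(3)] by blast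
  then show ?thesis
    using definable_subst[of "\<lambda>x s. P x (u s)"] assms(2) by blast
qed

lemma definable_subst3:
  assumes "definable (\<lambda>s. P (s 0) (s (Suc 0)) (s (Suc (Suc 0))))"
    "definable_term t" "definable_term u" "definable_term v"
  shows "definable (\<lambda>s. P (t s) (u s) (v s))"
proof -
  have "definable (\<lambda>s. P (s (Suc (Suc 0))) (s (Suc 0)) (s 0))"
    using definable_reindex[OF assms(1), of "\<lambda>i. if i = 0 then 2 else if i = 2 then 0 else i"]
    by (auto simp: inj_def numeral_2_eq_2 split: if_splits)
  then have "definable (\<lambda>s. P (s (Suc 0)) (s 0) (v (\<lambda>i. s (Suc (Suc i)))))"
    using definable_subst[of "\<lambda>z s. P (s (Suc 0)) (s 0) z"]
      definable_term_weaken[OF definable_term_weaken[OF assms(4)]] by blast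
  then have "definable (\<lambda>s. P (s 0) (u (\<lambda>i. s (Suc i))) (v (\<lambda>i. s (Suc i))))"
    using definable_subst[of "\<lambda>y s. P (s 0) y (v (\<lambda>i. s (Suc i)))"]
     definable_term_weaken[OF assms(3)] by blast
  then show ?thesis
    using definable_subst[of "\<lambda>x s. P x (u s) (v s)"] assms(2) by blast
qed

lemma definable_term_var [definable_intros]: "definable_term (\<lambda>s. s i)"
  unfolding definable_term_def by (rule definable_eq_var)

lemma definable_term_const [definable_intros]: "definable_term (\<lambda>s. c)"
  unfolding definable_term_def
  using definable_instance[of "\<lambda>x s. s 0 = x" c, OF definable_eq_var] by simp

lemma definable_mem [definable_intros]:
  "definable_term t \<Longrightarrow> definable_term u \<Longrightarrow> definable (\<lambda>s. E (t s) (u s))"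
  by (rule definable_subst2[of E]) (rule definable_mem_var)

lemma definable_eq [definable_intros]:
  "definable_term t \<Longrightarrow> definable_term u \<Longrightarrow> definable (\<lambda>s. t s = u s)"
  by (rule definable_subst2[of "(=)"]) (rule definable_eq_var)

lemma definable_ex1 [definable_intros]:
  assumes "definable (\<lambda>s. P (s 0) (\<lambda>i. s (Suc i)))"
  shows "definable (\<lambda>s. \<exists>!x. P x s)"
proof -
  have "definable (\<lambda>s. P (s 0) (\<lambda>i. s (Suc (Suc i))))"
    by (rule definable_skip[of P, OF assms])
  then show ?thesis
    unfolding Ex1_def using assms by (intro definable_intros)
qed

lemma definable_term_the1 [definable_intros]:
  assumes "definable (\<lambda>s. P (s 0) (\<lambda>i. s (Suc i)))"
  shows "definable_term (\<lambda>s. the1 (\<lambda>x. P x s))"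
proof -
  have "definable (\<lambda>s. P (s 0) (\<lambda>i. s (Suc (Suc i))))"
    by (rule definable_skip[of P, OF assms])
  then have "definable (\<lambda>s. ((\<exists>!x. P x (\<lambda>i. s (Suc i))) \<and> P (s 0) (\<lambda>i. s (Suc i))) \<or>
      (\<not> (\<exists>!x. P x (\<lambda>i. s (Suc i))) \<and> s 0 = undefined))"
    using assms by (intro definable_intros)
  moreover have "(y = the1 Q) \<longleftrightarrow> ((\<exists>!x. Q x) \<and> Q y) \<or> (\<not> (\<exists>!x. Q x) \<and> y = undefined)"
    for y and Q :: "'a \<Rightarrow> bool"
    using the1I[of Q] by (auto simp: the1_def)
  ultimately show ?thesis unfolding definable_term_def by simp
qed

lemma definable_term_if [definable_intros]:
  assumes "definable P" "definable_term t" "definable_term u"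
  shows "definable_term (\<lambda>s. if P s then t s else u s)"
proof -
  have "definable (\<lambda>s. P (\<lambda>i. s (Suc i)))"
    by (rule definable_reindex[OF assms(1) inj_Suc])
  then have *: "definable (\<lambda>s. (P (\<lambda>i. s (Suc i)) \<and> s 0 = t (\<lambda>i. s (Suc i))) \<or>
      (\<not> P (\<lambda>i. s (Suc i)) \<and> s 0 = u (\<lambda>i. s (Suc i))))"
    by (intro definable_disj definable_conj definable_not
        assms(2,3)[unfolded definable_term_def])
  have "(\<lambda>s. s 0 = (if P (\<lambda>i. s (Suc i)) then t (\<lambda>i. s (Suc i)) else u (\<lambda>i. s (Suc i)))) =
      (\<lambda>s. (P (\<lambda>i. s (Suc i)) \<and> s 0 = t (\<lambda>i. s (Suc i))) \<or>
        (\<not> P (\<lambda>i. s (Suc i)) \<and> s 0 = u (\<lambda>i. s (Suc i))))"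
    by (rule ext) simp
  with * show ?thesis unfolding definable_term_def by (simp only:)
qed

lemma definable_term_subst1:
  assumes "definable_term (\<lambda>s. F (s 0))" "definable_term t"
  shows "definable_term (\<lambda>s. F (t s))"
proof -
  have "definable (\<lambda>s. s 0 = F (s (Suc 0)))"
    using assms(1) unfolding definable_term_def .
  from definable_subst2[of "\<lambda>y x. y = F x" "\<lambda>s. s 0" "\<lambda>s. t (\<lambda>i. s (Suc i))", OF this definable_term_var
      definable_term_weaken[OF assms(2)]]
  show ?thesis unfolding definable_term_def .
qed

lemma definable_term_subst2:
  assumes "definable_term (\<lambda>s. F (s 0) (s (Suc 0)))" "definable_term t" "definable_term u"
  shows "definable_term (\<lambda>s. F (t s) (u s))"
proof -
  have "definable (\<lambda>s. s 0 = F (s (Suc 0)) (s (Suc (Suc 0))))"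
    using assms(1) unfolding definable_term_def .
  from definable_subst3[of "\<lambda>z x y. z = F x y" "\<lambda>s. s 0" "\<lambda>s. t (\<lambda>i. s (Suc i))"
     "\<lambda>s. u (\<lambda>i. s (Suc i))", OF this definable_term_var
      definable_term_weaken[OF assms(2)] definable_term_weaken[OF assms(3)]]
  show ?thesis unfolding definable_term_def .
qed

section \<open>Sets of the model and their extensions\<close>

text \<open>A HOL set is an \<open>isset\<close> if it is the extension of some individual, which is then its
  \<open>code\<close>. Definability of a code only needs definability of membership, because
  \<open>the1\<close> is definable even where no set with that extension exists.\<close>

definition ext :: "'a \<Rightarrow> 'a set" where
  "ext x = {z. E z x}"

definition isset :: "'a set \<Rightarrow> bool" where
  "isset A \<longleftrightarrow> (\<exists>x. ext x = A)"

definition code :: "'a set \<Rightarrow> 'a" where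
  "code A = the1 (\<lambda>x. \<forall>z. E z x \<longleftrightarrow> z \<in> A)"

lemma mem_ext [simp]: "z \<in> ext x \<longleftrightarrow> E z x"
  by (simp add: ext_def)

lemma ext_inject: "ext x = ext y \<longleftrightarrow> x = y"
  using extensionality by (auto simp: ext_def)

lemma isset_ext [simp, intro]: "isset (ext x)"
  by (auto simp: isset_def)

lemma code_ext [simp]: "code (ext x) = x"
  unfolding code_def by (rule the1_eqI) (auto intro: extensionality)

lemma ext_code: "isset A \<Longrightarrow> ext (code A) = A"
  by (auto simp: isset_def)

lemma mem_code: "isset A \<Longrightarrow> E z (code A) \<longleftrightarrow> z \<in> A"
  by (simp add: ext_code flip: mem_ext)

lemma issetI: "\<exists>v. \<forall>z. E z v \<longleftrightarrow> z \<in> A \<Longrightarrow> isset A"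
  by (auto simp: isset_def ext_def)

lemma definable_ext [definable_intros]:
  "definable_term t \<Longrightarrow> definable_term u \<Longrightarrow> definable (\<lambda>s. t s \<in> ext (u s))"
  unfolding mem_ext by (rule definable_mem)

lemma definable_Collect [definable_intros]:
  "definable (\<lambda>s. P (t s) s) \<Longrightarrow> definable (\<lambda>s. t s \<in> {x. P x s})"
  by simp

lemma definable_insert [definable_intros]:
  "definable (\<lambda>s. t s = u s \<or> t s \<in> A s) \<Longrightarrow> definable (\<lambda>s. t s \<in> insert (u s) (A s))"
  by simp

lemma definable_empty [definable_intros]: "definable (\<lambda>s. t s \<in> {})"
  using definable_true[of False] by simp

lemma definable_Un [definable_intros]:
  "definable (\<lambda>s. t s \<in> A s \<or> t s \<in> B s) \<Longrightarrow> definable (\<lambda>s. t s \<in> A s \<union> B s)"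
  by simp

lemma definable_image [definable_intros]:
  "definable (\<lambda>s. \<exists>x. x \<in> A s \<and> t s = F x s) \<Longrightarrow> definable (\<lambda>s. t s \<in> (\<lambda>x. F x s) ` A s)"
  by (simp add: image_iff Bex_def)

lemma definable_subseteq [definable_intros]:
  "definable (\<lambda>s. \<forall>x. x \<in> A s \<longrightarrow> x \<in> B s) \<Longrightarrow> definable (\<lambda>s. A s \<subseteq> B s)"
  by (simp add: subset_iff)

lemma definable_inj_on [definable_intros]:
  "definable (\<lambda>s. \<forall>x. x \<in> A s \<longrightarrow> (\<forall>y. y \<in> A s \<longrightarrow> F x s = F y s \<longrightarrow> x = y)) \<Longrightarrow>
    definable (\<lambda>s. inj_on (\<lambda>x. F x s) (A s))"
  by (simp add: inj_on_def Ball_def)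

text \<open>A fixed set may occur in a definable predicate, with its code as a parameter.\<close>

lemma definable_isset:
  assumes "isset A" "definable_term t"
  shows "definable (\<lambda>s. t s \<in> A)"
proof -
  obtain a where "A = ext a" using assms(1) by (auto simp: isset_def)
  then show ?thesis using assms(2) by (simp add: definable_mem definable_term_const)
qed

lemma definable_term_code [definable_intros]:
  assumes "definable (\<lambda>s. s 0 \<in> A (\<lambda>i. s (Suc i)))"
  shows "definable_term (\<lambda>s. code (A s))"
proof -
  have "definable (\<lambda>s. s 0 \<in> A (\<lambda>i. s (Suc (Suc i))))"
    by (rule definable_skip[of "\<lambda>x s. x \<in> A s", OF assms])
  then show ?thesis unfolding code_def
    by (intro definable_term_the1 definable_all definable_iff definable_mem definable_term_var)
qed

text \<open>A class function of the structure.\<close>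

abbreviation definable_fun :: "('a \<Rightarrow> 'a) \<Rightarrow> bool" where
  "definable_fun F \<equiv> definable_term (\<lambda>s. F (s 0))"

text \<open>Overwriting the free variables leaves the odd positions alone, so the parameters supplied by
  \<open>definable\<close> serve as the parameters of the Separation scheme.\<close>

lemma isset_sep:
  assumes "isset A" "definable (\<lambda>s. P (s 0))"
  shows "isset {z \<in> A. P z}"
proof -
  obtain u where u: "A = ext u" using assms(1) by (auto simp: isset_def)
  obtain \<phi> p where P: "\<And>s. P (s 0) \<longleftrightarrow> sat E (interleave s p) \<phi>"
    using assms(2) unfolding definable_def by auto
  have "(interleave s p)(0 := z) = interleave (s(0 := z)) p" for s z
    by (rule interleave_eqI) auto
  then have "P z \<longleftrightarrow> sat E ((interleave undefined p)(0 := z)) \<phi>" for z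
    using P[of "undefined(0 := z)"] by simp
  then show ?thesis
    using separation[of u "interleave undefined p" \<phi>] by (intro issetI) (simp add: u)
qed

text \<open>In the Replacement scheme the value of the function is variable \<open>1\<close>, an odd position; the value
  is therefore pushed onto the parameters.\<close>

lemma isset_image:
  assumes "isset A" "definable_fun F"
  shows "isset (F ` A)"
proof -
  obtain u where u: "A = ext u" using assms(1) by (auto simp: isset_def)
  have "definable (\<lambda>s. s 0 = F (s (Suc 0)))"
    using assms(2) unfolding definable_term_def .
  from definable_push[of "\<lambda>y s. y = F (s 0)", OF this]
  obtain \<phi> p where P: "\<And>y s. y = F (s 0) \<longleftrightarrow> sat E (interleave s (case_nat y p)) \<phi>"
    by blast
  define r where "r = interleave undefined (case_nat undefined p)"
  have "r(0 := x, 1 := y) = interleave (undefined(0 := x)) (case_nat y p)" for x y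
    by (rule interleave_eqI)
      (auto simp: r_def interleave_odd[of _ _ 0, simplified] split: nat.splits)
  then have "sat E (r(0 := x, 1 := y)) \<phi> \<longleftrightarrow> y = F x" for x y
    using P[of y "undefined(0 := x)"] by simp
  then show ?thesis
    using replacement[of u r \<phi>] by (intro issetI) (simp add: u image_iff Bex_def)
qed

lemma isset_empty [simp]: "isset {}"
  using isset_sep[of "ext undefined" "\<lambda>z. False", OF isset_ext definable_true] by simp

lemma isset_pair [simp]: "isset {a, b}"
  using pairing[of a b] by (intro issetI) (auto simp: is_upair_def)

lemma isset_singleton [simp]: "isset {a}"
  using isset_pair[of a a] by simp

lemma isset_Union: "isset A \<Longrightarrow> isset (\<Union>x\<in>A. ext x)"
  using union by (intro issetI) (auto simp: isset_def Bex_def)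

lemma isset_UN:
  assumes "isset A" "definable_fun F" "\<And>x. x \<in> A \<Longrightarrow> ext (F x) = B x"
  shows "isset (\<Union>x\<in>A. B x)"
  using isset_Union[OF isset_image[OF assms(1,2)]] assms(3) by simp

lemma isset_Un [intro]:
  assumes "isset A" "isset B"
  shows "isset (A \<union> B)"
  using isset_Union[of "{code A, code B}"] assms by (simp add: ext_code)

lemma isset_insert [intro]: "isset A \<Longrightarrow> isset (insert a A)"
  using isset_Un[of "{a}" A] by simp

lemma isset_Pow: "isset A \<Longrightarrow> isset {y. ext y \<subseteq> A}"
  using power_set by (intro issetI) (auto simp: isset_def subset_iff)

section \<open>Pairs, products and functions of the model\<close>

definition upair :: "'a \<Rightarrow> 'a \<Rightarrow> 'a" where
  "upair a b = code {a, b}"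

definition opair :: "'a \<Rightarrow> 'a \<Rightarrow> 'a" where
  "opair a b = upair (upair a a) (upair a b)"

lemma ext_upair [simp]: "ext (upair a b) = {a, b}"
  by (simp add: upair_def ext_code)

lemma is_upair_iff: "is_upair E a b p \<longleftrightarrow> p = upair a b"
  by (auto simp: is_upair_def ext_inject[symmetric] set_eq_iff)

lemma upair_eq_iff: "upair a b = upair c d \<longleftrightarrow> {a, b} = {c, d}"
  by (metis ext_upair upair_def)

lemma is_opair_iff: "is_opair E a b p \<longleftrightarrow> p = opair a b"
  by (simp add: is_opair_def is_upair_iff opair_def)

lemma maps_iff: "maps E f a b \<longleftrightarrow> E (opair a b) f"
  by (simp add: maps_def is_opair_iff)

lemma opair_inject [simp]: "opair a b = opair c d \<longleftrightarrow> a = c \<and> b = d"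
  by (auto simp: opair_def upair_eq_iff doubleton_eq_iff)

lemma definable_term_upair [definable_intros]:
  "definable_term t \<Longrightarrow> definable_term u \<Longrightarrow> definable_term (\<lambda>s. upair (t s) (u s))"
  by (rule definable_term_subst2[of upair], unfold upair_def) (intro definable_intros)

lemma definable_term_opair [definable_intros]:
  "definable_term t \<Longrightarrow> definable_term u \<Longrightarrow> definable_term (\<lambda>s. opair (t s) (u s))"
  by (rule definable_term_subst2[of opair], unfold opair_def) (intro definable_intros)

definition oprod :: "'a set \<Rightarrow> 'a set \<Rightarrow> 'a set" where
  "oprod A B = {opair a b | a b. a \<in> A \<and> b \<in> B}"

definition ofst :: "'a \<Rightarrow> 'a" where
  "ofst p = the1 (\<lambda>a. \<exists>b. p = opair a b)"

definition osnd :: "'a \<Rightarrow> 'a" where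
  "osnd p = the1 (\<lambda>b. \<exists>a. p = opair a b)"

lemma ofst_opair [simp]: "ofst (opair a b) = a"
  unfolding ofst_def by (rule the1_eqI) auto

lemma osnd_opair [simp]: "osnd (opair a b) = b"
  unfolding osnd_def by (rule the1_eqI) auto

lemma definable_term_ofst [definable_intros]:
  "definable_term t \<Longrightarrow> definable_term (\<lambda>s. ofst (t s))"
  by (rule definable_term_subst1[of ofst], unfold ofst_def) (intro definable_intros)

lemma definable_term_osnd [definable_intros]:
  "definable_term t \<Longrightarrow> definable_term (\<lambda>s. osnd (t s))"
  by (rule definable_term_subst1[of osnd], unfold osnd_def) (intro definable_intros)

lemma isset_oprod [intro]:
  assumes "isset A" "isset B"
  shows "isset (oprod A B)"
proof -
  have "oprod A B = (\<Union>a\<in>A. (\<lambda>b. opair a b) ` B)"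
    by (auto simp: oprod_def)
  moreover have "isset (\<Union>a\<in>A. (\<lambda>b. opair a b) ` B)"
  proof (rule isset_UN[OF assms(1)])
    show "definable_fun (\<lambda>a. code ((\<lambda>b. opair a b) ` B))"
      by (intro definable_intros definable_isset[OF assms(2)])
    show "ext (code ((\<lambda>b. opair a b) ` B)) = (\<lambda>b. opair a b) ` B" for a
      by (intro ext_code isset_image assms definable_intros)
  qed
  ultimately show ?thesis by simp
qed

definition app :: "'a \<Rightarrow> 'a \<Rightarrow> 'a" where
  "app f a = the1 (\<lambda>b. E (opair a b) f)"

lemma definable_term_app [definable_intros]:
  "definable_term t \<Longrightarrow> definable_term u \<Longrightarrow> definable_term (\<lambda>s. app (t s) (u s))"
  by (rule definable_term_subst2[of app], unfold app_def) (intro definable_intros)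

text \<open>Every definable function, restricted to a set, is coded by an individual and recovered by
  \<open>app\<close>; this is what allows quantification over functions inside definable predicates.\<close>

definition graph :: "('a \<Rightarrow> 'a) \<Rightarrow> 'a set \<Rightarrow> 'a" where
  "graph F A = code ((\<lambda>a. opair a (F a)) ` A)"

lemma ext_graph:
  assumes "isset A" "definable_fun F"
  shows "ext (graph F A) = (\<lambda>a. opair a (F a)) ` A"
  unfolding graph_def
  by (intro ext_code isset_image assms definable_term_opair definable_term_var)

lemma app_graph:
  assumes "isset A" "definable_fun F" "a \<in> A"
  shows "app (graph F A) a = F a"
proof -
  have "E p (graph F A) \<longleftrightarrow> p \<in> (\<lambda>a. opair a (F a)) ` A" for p
    using ext_graph[OF assms(1,2)] by (simp flip: mem_ext)
  then have "E (opair a b) (graph F A) \<longleftrightarrow> b = F a" for b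
    using assms(3) by auto
  then show ?thesis unfolding app_def by (simp add: the1_eqI)
qed

lemma definable_fun_app: "definable_fun (app f)"
  by (intro definable_intros)

lemma definable_fun_comp: "definable_fun F \<Longrightarrow> definable_fun G \<Longrightarrow> definable_fun (\<lambda>x. G (F x))"
  by (rule definable_term_subst1[of G])

text \<open>From here on bijections of the model can be replaced by definable HOL bijections.\<close>

lemma equinumerous_iff:
  "equinumerous E x y \<longleftrightarrow> (\<exists>F. definable_fun F \<and> bij_betw F (ext x) (ext y))"
proof
  assume "equinumerous E x y"
  then obtain f where f: "is_bijection E f x y" by (auto simp: equinumerous_def)
  then have total: "\<exists>!b. E (opair a b) f" if "E a x" for a
    using that by (auto simp: is_bijection_def maps_iff)
  have f1: "E (opair a (app f a)) f" if "E a x" for a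
    unfolding app_def by (rule the1I[OF total[OF that]])
  have f2: "E a x \<and> E b y" if "E (opair a b) f" for a b
    using f that unfolding is_bijection_def is_opair_iff by force
  have f3: "a = a'" if "E (opair a b) f" "E (opair a' b) f" for a a' b
    using f f2[OF that(1)] that unfolding is_bijection_def maps_iff is_opair_iff by blast
  have "bij_betw (app f) (ext x) (ext y)"
  proof (rule bij_betwI')
    show "app f a = app f a' \<longleftrightarrow> a = a'" if "a \<in> ext x" "a' \<in> ext x" for a a'
      using f1[of a] f1[of a'] f3 that by auto
    show "app f a \<in> ext y" if "a \<in> ext x" for a
      using f1[of a] f2 that by auto
    show "\<exists>a\<in>ext x. b = app f a" if b: "b \<in> ext y" for b
    proof -
      obtain a where "E (opair a b) f"
        using f b unfolding is_bijection_def maps_iff is_opair_iff mem_ext by blast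
      then show ?thesis using f1[of a] f2 total by (metis mem_ext)
    qed
  qed
  then show "\<exists>F. definable_fun F \<and> bij_betw F (ext x) (ext y)"
    using definable_fun_app by blast
next
  assume "\<exists>F. definable_fun F \<and> bij_betw F (ext x) (ext y)"
  then obtain F where F: "definable_fun F" and bij: "bij_betw F (ext x) (ext y)" by blast
  have E_graph: "E p (graph F (ext x)) \<longleftrightarrow> (\<exists>a. E a x \<and> p = opair a (F a))" for p
    using ext_graph[OF isset_ext F, of x] by (auto simp: set_eq_iff image_iff)
  have into: "E (F a) y" if "E a x" for a
    using bij_betwE[OF bij] that by simp
  have onto: "\<exists>!a. E a x \<and> b = F a" if "E b y" for b
  proof (rule ex_ex1I)
    show "\<exists>a. E a x \<and> b = F a"
      using bij that by (auto simp: bij_betw_def image_iff set_eq_iff Bex_def)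
    show "a = a'" if "E a x \<and> b = F a" "E a' x \<and> b = F a'" for a a'
      using bij that by (auto simp: bij_betw_def inj_on_def)
  qed
  have "is_bijection E (graph F (ext x)) x y"
    unfolding is_bijection_def maps_iff is_opair_iff E_graph
    using into onto by auto
  then show "equinumerous E x y" by (auto simp: equinumerous_def)
qed

lemma definable_fun_inv:
  assumes "definable_fun F" "isset A"
  obtains G where "definable_fun G" "\<And>a. inj_on F A \<Longrightarrow> a \<in> A \<Longrightarrow> G (F a) = a"
proof
  show "definable_fun (\<lambda>b. the1 (\<lambda>a. a \<in> A \<and> F a = b))"
    by (intro definable_intros definable_isset[OF assms(2)] definable_term_subst1[OF assms(1)])
  show "the1 (\<lambda>a'. a' \<in> A \<and> F a' = F a) = a" if "inj_on F A" "a \<in> A" for a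
    using that by (intro the1_eqI) (auto dest: inj_onD)
qed

lemma equinumerous_refl: "equinumerous E x x"
  unfolding equinumerous_iff
  by (intro exI[of _ "\<lambda>x. x"] conjI definable_intros) (simp add: bij_betw_def)

lemma equinumerous_sym:
  assumes "equinumerous E x y"
  shows "equinumerous E y x"
proof -
  obtain F where F: "definable_fun F" "bij_betw F (ext x) (ext y)"
    using assms by (auto simp: equinumerous_iff)
  obtain G where G: "definable_fun G" "\<And>a. inj_on F (ext x) \<Longrightarrow> a \<in> ext x \<Longrightarrow> G (F a) = a"
    using definable_fun_inv[OF F(1) isset_ext[of x]] by blast
  have "bij_betw G (ext y) (ext x)"
    using F(2) G(2) bij_betw_cong[of "ext x" "\<lambda>a. G (F a)" "\<lambda>a. a" "ext x"]
    by (subst bij_betw_comp_iff[OF F(2)]) (auto simp: bij_betw_def comp_def)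
  then show ?thesis using G(1) by (auto simp: equinumerous_iff)
qed

lemma equinumerous_trans:
  assumes "equinumerous E x y" "equinumerous E y z"
  shows "equinumerous E x z"
proof -
  obtain F G where "definable_fun F" "bij_betw F (ext x) (ext y)"
    "definable_fun G" "bij_betw G (ext y) (ext z)"
    using assms by (auto simp: equinumerous_iff)
  then have "bij_betw (\<lambda>a. G (F a)) (ext x) (ext z)" "definable_fun (\<lambda>a. G (F a))"
    using bij_betw_trans[of F "ext x" "ext y" G "ext z"] definable_fun_comp[of F G]
    by (simp_all add: comp_def)
  then show ?thesis unfolding equinumerous_iff by (intro exI[of _ "\<lambda>a. G (F a)"]) simp
qed

section \<open>Injections\<close>

definition embeds :: "'a set \<Rightarrow> 'a set \<Rightarrow> bool" where
  "embeds A B \<longleftrightarrow> (\<exists>F. definable_fun F \<and> inj_on F A \<and> F ` A \<subseteq> B)"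

lemma embedsI: "definable_fun F \<Longrightarrow> inj_on F A \<Longrightarrow> F ` A \<subseteq> B \<Longrightarrow> embeds A B"
  by (auto simp: embeds_def)

text \<open>Quantifying over codes instead of definable functions makes the notion first-order.\<close>

lemma embeds_iff_app:
  assumes "isset A"
  shows "embeds A B \<longleftrightarrow> (\<exists>f. inj_on (app f) A \<and> app f ` A \<subseteq> B)"
proof
  assume "embeds A B"
  then obtain F where F: "definable_fun F" "inj_on F A" "F ` A \<subseteq> B"
    by (auto simp: embeds_def)
  have "app (graph F A) a = F a" if "a \<in> A" for a
    using app_graph[OF assms F(1) that] .
  then have "inj_on (app (graph F A)) A" "app (graph F A) ` A \<subseteq> B"
    using F(2,3) by (auto simp: inj_on_def)
  then show "\<exists>f. inj_on (app f) A \<and> app f ` A \<subseteq> B" by blast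
qed (use definable_fun_app in \<open>auto simp: embeds_def\<close>)

lemma definable_embeds [definable_intros]:
  assumes "\<And>s. isset (A s)" "definable (\<lambda>s. \<exists>f. inj_on (app f) (A s) \<and> app f ` A s \<subseteq> B s)"
  shows "definable (\<lambda>s. embeds (A s) (B s))"
  using assms(2) by (simp add: embeds_iff_app[OF assms(1)])

lemma definable_oprod [definable_intros]:
  assumes "definable (\<lambda>s. ofst (t s) \<in> A s \<and> osnd (t s) \<in> B s \<and> t s = opair (ofst (t s)) (osnd (t s)))"
  shows "definable (\<lambda>s. t s \<in> oprod (A s) (B s))"
proof -
  have "t s \<in> oprod (A s) (B s) \<longleftrightarrow>
      ofst (t s) \<in> A s \<and> osnd (t s) \<in> B s \<and> t s = opair (ofst (t s)) (osnd (t s))" for s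
    unfolding oprod_def mem_Collect_eq by (metis ofst_opair osnd_opair)
  then show ?thesis using assms by (simp only:)
qed

lemma embeds_trans:
  assumes "embeds A B" "embeds B C"
  shows "embeds A C"
proof -
  obtain F G where F: "definable_fun F" "inj_on F A" "F ` A \<subseteq> B"
    and G: "definable_fun G" "inj_on G B" "G ` B \<subseteq> C"
    using assms by (auto simp: embeds_def)
  show ?thesis
  proof (rule embedsI)
    show "definable_fun (\<lambda>x. G (F x))" by (rule definable_fun_comp[OF F(1) G(1)])
    show "inj_on (\<lambda>x. G (F x)) A"
      using comp_inj_on[OF F(2) inj_on_subset[OF G(2) F(3)]] by (simp add: comp_def)
    show "(\<lambda>x. G (F x)) ` A \<subseteq> C" using F(3) G(3) by auto
  qed
qed

lemma embeds_subset: "A \<subseteq> B \<Longrightarrow> embeds A B"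
  by (rule embedsI[OF definable_term_var]) auto

lemma embeds_if_equinumerous: "equinumerous E x y \<Longrightarrow> embeds (ext x) (ext y)"
  by (auto simp: equinumerous_iff embeds_def bij_betw_def)

lemma embeds_oprod:
  assumes "embeds A B"
  shows "embeds (oprod A A) (oprod B B)"
proof -
  obtain F where F: "definable_fun F" "inj_on F A" "F ` A \<subseteq> B"
    using assms by (auto simp: embeds_def)
  show ?thesis
  proof (rule embedsI)
    show "definable_fun (\<lambda>p. opair (F (ofst p)) (F (osnd p)))"
      by (intro definable_intros definable_term_subst1[OF F(1)])
    show "inj_on (\<lambda>p. opair (F (ofst p)) (F (osnd p))) (oprod A A)"
      using F(2) by (auto simp: inj_on_def oprod_def)
    show "(\<lambda>p. opair (F (ofst p)) (F (osnd p))) ` oprod A A \<subseteq> oprod B B"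
      using F(3) by (force simp: oprod_def)
  qed
qed

lemma embeds_inverse:
  assumes "isset A" "definable_fun F" "inj_on F A"
  shows "embeds (F ` A) A"
proof -
  obtain G where G: "definable_fun G" "\<And>a. inj_on F A \<Longrightarrow> a \<in> A \<Longrightarrow> G (F a) = a"
    using definable_fun_inv[OF assms(2,1)] by blast
  show ?thesis
    by (rule embedsI[OF G(1)]) (auto simp: inj_on_def G(2)[OF assms(3)])
qed

section \<open>Natural numbers and ordinals of the model\<close>

definition zero :: 'a where
  "zero = code {}"

definition succ :: "'a \<Rightarrow> 'a" where
  "succ x = code (insert x (ext x))"

lemma ext_zero [simp]: "ext zero = {}"
  by (simp add: zero_def ext_code)

lemma not_mem_zero [simp]: "\<not> E x zero"
  by (simp flip: mem_ext)

lemma ext_succ [simp]: "ext (succ x) = insert x (ext x)"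
  unfolding succ_def by (intro ext_code isset_insert isset_ext)

lemma mem_succ: "E y (succ x) \<longleftrightarrow> y = x \<or> E y x"
  by (simp flip: mem_ext)

lemma definable_term_succ [definable_intros]:
  "definable_term t \<Longrightarrow> definable_term (\<lambda>s. succ (t s))"
  by (rule definable_term_subst1[of succ], unfold succ_def) (intro definable_intros)

lemma is_inductive_iff: "is_inductive E I \<longleftrightarrow> E zero I \<and> (\<forall>x. E x I \<longrightarrow> E (succ x) I)"
proof -
  have "is_empty_set E e \<longleftrightarrow> e = zero" for e
    by (auto simp: is_empty_set_def ext_inject[symmetric] set_eq_iff)
  moreover have "is_succ E x s \<longleftrightarrow> s = succ x" for x s
    by (auto simp: is_succ_def ext_inject[symmetric] set_eq_iff)
  ultimately show ?thesis by (simp add: is_inductive_def)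
qed

definition omega :: "'a set" where
  "omega = {n. is_natural E n}"

lemma definable_is_natural: "definable (\<lambda>s. is_natural E (s 0))"
  unfolding is_natural_def is_inductive_iff by (intro definable_intros)

lemma isset_omega [simp, intro]: "isset omega"
proof -
  obtain I where I: "is_inductive E I" using infinity by blast
  have "isset {n \<in> ext I. is_natural E n}"
    by (rule isset_sep[OF isset_ext definable_is_natural])
  moreover have "{n \<in> ext I. is_natural E n} = omega"
    using I by (auto simp: omega_def is_natural_def)
  ultimately show ?thesis by simp
qed

lemma zero_in_omega [simp]: "zero \<in> omega"
  by (simp add: omega_def is_natural_def is_inductive_iff)

lemma succ_in_omega: "n \<in> omega \<Longrightarrow> succ n \<in> omega"
  by (simp add: omega_def is_natural_def is_inductive_iff)

text \<open>Induction holds for definable predicates only, since a nonstandard \<open>\<omega>\<close> has HOL subsets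
  that are inductive, for instance the standard numbers, but not sets of the model.\<close>

lemma omega_induct:
  assumes "n \<in> omega" "definable (\<lambda>s. P (s 0))" "P zero"
    "\<And>n. n \<in> omega \<Longrightarrow> P n \<Longrightarrow> P (succ n)"
  shows "P n"
proof -
  define I where "I = code {n \<in> omega. P n}"
  have I: "E x I \<longleftrightarrow> x \<in> omega \<and> P x" for x
    unfolding I_def by (subst mem_code[OF isset_sep[OF isset_omega assms(2)]]) simp
  have "is_inductive E I"
    unfolding is_inductive_iff I using assms(3,4) succ_in_omega by auto
  then have "E n I" using assms(1) by (simp add: omega_def is_natural_def)
  then show ?thesis by (simp add: I)
qed

lemma foundation_set:
  assumes "isset A" "A \<noteq> {}"
  obtains y where "y \<in> A" "\<And>z. E z y \<Longrightarrow> z \<notin> A"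
proof -
  obtain x where x: "A = ext x" using assms(1) by (auto simp: isset_def)
  then have "\<exists>y. E y x" using assms(2) by auto
  from foundation[OF this] show ?thesis using x that by auto
qed

lemma not_mem_self [simp]: "\<not> E x x"
  using foundation_set[of "{x}"] by auto

text \<open>With Foundation, an ordinal is a transitive set of transitive sets: \<open>\<in>\<close> is then
  automatically a well-ordering on it.\<close>

definition transitive :: "'a \<Rightarrow> bool" where
  "transitive x \<longleftrightarrow> (\<forall>y. E y x \<longrightarrow> (\<forall>z. E z y \<longrightarrow> E z x))"

definition ordinal :: "'a \<Rightarrow> bool" where
  "ordinal x \<longleftrightarrow> transitive x \<and> (\<forall>y. E y x \<longrightarrow> transitive y)"

lemma definable_ordinal [definable_intros]:
  "definable_term t \<Longrightarrow> definable (\<lambda>s. ordinal (t s))"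
  by (rule definable_subst1[of ordinal], unfold ordinal_def transitive_def) (intro definable_intros)

lemma ordinal_trans: "ordinal x \<Longrightarrow> E y x \<Longrightarrow> E z y \<Longrightarrow> E z x"
  unfolding ordinal_def transitive_def by blast

lemma ordinal_subset: "ordinal x \<Longrightarrow> E y x \<Longrightarrow> ext y \<subseteq> ext x"
  using ordinal_trans by auto

lemma ordinal_mem: "ordinal x \<Longrightarrow> E y x \<Longrightarrow> ordinal y"
  unfolding ordinal_def transitive_def by blast

lemma ordinal_zero: "ordinal zero"
  by (simp add: ordinal_def transitive_def)

lemma ordinal_succ: "ordinal x \<Longrightarrow> ordinal (succ x)"
  unfolding ordinal_def transitive_def mem_succ by blast

lemma ordinal_induct:
  assumes "ordinal x" "definable (\<lambda>s. P (s 0))"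
    "\<And>x. ordinal x \<Longrightarrow> (\<And>y. E y x \<Longrightarrow> P y) \<Longrightarrow> P x"
  shows "P x"
proof (rule ccontr)
  assume "\<not> P x"
  define A where "A = {y \<in> ext (succ x). \<not> P y}"
  have "isset A" unfolding A_def
    by (rule isset_sep[OF isset_ext definable_not[OF assms(2)]])
  moreover have "A \<noteq> {}" using \<open>\<not> P x\<close> by (auto simp: A_def)
  ultimately obtain y where y: "y \<in> A" "\<And>z. E z y \<Longrightarrow> z \<notin> A"
    by (rule foundation_set) blast
  have "E y (succ x)" "\<not> P y" using y(1) by (auto simp: A_def mem_succ)
  moreover have "ordinal y"
    using ordinal_mem[OF ordinal_succ[OF assms(1)] \<open>E y (succ x)\<close>] .
  moreover have "P z" if "E z y" for z
    using y(2)[OF that] ordinal_trans[OF ordinal_succ[OF assms(1)] \<open>E y (succ x)\<close> that]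
    by (auto simp: A_def mem_succ)
  ultimately show False using assms(3) by blast
qed

lemma ordinal_least:
  assumes "ordinal x" "P x" "definable (\<lambda>s. P (s 0))"
  obtains y where "ordinal y" "P y" "\<And>z. E z y \<Longrightarrow> \<not> P z"
  using ordinal_induct[OF assms(1) definable_not[OF assms(3)]] assms(2) by blast

text \<open>By a double induction: if all elements of \<open>x\<close> are comparable with \<open>y\<close> and all elements of
  \<open>y\<close> with \<open>x\<close>, and neither \<open>x \<in> y\<close> nor \<open>y \<in> x\<close>, then each is contained in the other.\<close>

lemma ordinal_linear:
  assumes "ordinal x" "ordinal y"
  shows "E x y \<or> x = y \<or> E y x"
proof -
  have "\<forall>y. ordinal y \<longrightarrow> E x y \<or> x = y \<or> E y x"
    using assms(1)
  proof (rule ordinal_induct)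
    show "definable (\<lambda>s. \<forall>y. ordinal y \<longrightarrow> E (s 0) y \<or> s 0 = y \<or> E y (s 0))"
      by (intro definable_intros)
  next
    fix x assume x: "ordinal x" and IHx: "\<And>z. E z x \<Longrightarrow> \<forall>y. ordinal y \<longrightarrow> E z y \<or> z = y \<or> E y z"
    show "\<forall>y. ordinal y \<longrightarrow> E x y \<or> x = y \<or> E y x"
    proof (intro allI impI)
      fix y assume "ordinal y"
      then show "E x y \<or> x = y \<or> E y x"
      proof (rule ordinal_induct)
        show "definable (\<lambda>s. E x (s 0) \<or> x = s 0 \<or> E (s 0) x)"
          by (intro definable_intros)
      next
        fix y assume y: "ordinal y" and IHy: "\<And>z. E z y \<Longrightarrow> E x z \<or> x = z \<or> E z x"
        show "E x y \<or> x = y \<or> E y x"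
        proof (rule ccontr)
          assume neg: "\<not> (E x y \<or> x = y \<or> E y x)"
          have "E z y" if "E z x" for z
            using IHx[OF that] y neg that ordinal_trans[OF x that] by blast
          moreover have "E z x" if "E z y" for z
            using IHy[OF that] neg that ordinal_trans[OF y that] by blast
          ultimately have "x = y" by (intro extensionality) blast
          with neg show False by blast
        qed
      qed
    qed
  qed
  then show ?thesis using assms(2) by blast
qed

lemma ordinal_subset_or_mem: "ordinal x \<Longrightarrow> ordinal y \<Longrightarrow> ext x \<subseteq> ext y \<or> E y x"
  using ordinal_linear[of x y] ordinal_subset[of y x] by blast

lemma ordinal_code:
  assumes "isset A" "\<And>x. x \<in> A \<Longrightarrow> ordinal x" "\<And>x y. x \<in> A \<Longrightarrow> E y x \<Longrightarrow> y \<in> A"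
  shows "ordinal (code A)"
  using assms(2,3) unfolding ordinal_def transitive_def mem_code[OF assms(1)] by blast

lemma ordinal_natural: "n \<in> omega \<Longrightarrow> ordinal n"
  by (rule omega_induct[where P = ordinal])
    (auto intro: definable_intros ordinal_zero ordinal_succ)

lemma mem_natural: "n \<in> omega \<Longrightarrow> E k n \<Longrightarrow> k \<in> omega"
proof -
  assume "n \<in> omega"
  then have "\<forall>k. E k n \<longrightarrow> k \<in> omega"
    by (rule omega_induct)
      (auto intro!: definable_intros definable_isset simp: mem_succ)
  then show "E k n \<Longrightarrow> k \<in> omega" by blast
qed

lemma ordinal_omega: "ordinal (code omega)"
  by (rule ordinal_code) (auto intro: ordinal_natural mem_natural)

definition least_ordinal :: "('a \<Rightarrow> bool) \<Rightarrow> 'a" where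
  "least_ordinal P = the1 (\<lambda>x. ordinal x \<and> P x \<and> (\<forall>y. E y x \<longrightarrow> \<not> P y))"

lemma definable_term_least_ordinal [definable_intros]:
  assumes "definable (\<lambda>s. P (s 0) (\<lambda>i. s (Suc i)))"
  shows "definable_term (\<lambda>s. least_ordinal (\<lambda>x. P x s))"
proof -
  have "definable (\<lambda>s. P (s 0) (\<lambda>i. s (Suc (Suc i))))"
    by (rule definable_skip[of P, OF assms])
  then show ?thesis
    unfolding least_ordinal_def
    by (intro definable_term_the1 definable_all definable_conj definable_ordinal definable_imp
        definable_not definable_mem definable_term_var assms)
qed

lemma least_ordinal:
  assumes "ordinal x" "P x" "definable (\<lambda>s. P (s 0))"
  shows "P (least_ordinal P)" "ordinal (least_ordinal P)"
    "\<And>y. E y (least_ordinal P) \<Longrightarrow> \<not> P y"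
proof -
  obtain y where "ordinal y" "P y" "\<And>z. E z y \<Longrightarrow> \<not> P z"
    using ordinal_least[OF assms] by blast
  then have "\<exists>!x. ordinal x \<and> P x \<and> (\<forall>y. E y x \<longrightarrow> \<not> P y)"
    using ordinal_linear by blast
  from the1I[OF this] show "P (least_ordinal P)" "ordinal (least_ordinal P)"
      "\<And>y. E y (least_ordinal P) \<Longrightarrow> \<not> P y"
    unfolding least_ordinal_def by blast+
qed

text \<open>Choosing the least preimage turns a map from an ordinal onto \<open>A\<close> into an injection without
  any use of choice.\<close>

lemma embeds_if_surj:
  assumes "definable_fun F" "ordinal x" "A \<subseteq> F ` ext x"
  shows "embeds A (ext x)"
proof -
  define G where "G a = least_ordinal (\<lambda>y. E y x \<and> a = F y)" for a
  have "E (G a) x \<and> a = F (G a)" if a: "a \<in> A" for a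
  proof -
    obtain y where "E y x" "a = F y" using a assms(3) by auto
    moreover have "definable (\<lambda>s. E (s 0) x \<and> a = F (s 0))"
      by (intro definable_intros assms(1))
    ultimately show ?thesis
      unfolding G_def
      using least_ordinal(1)[of y "\<lambda>y. E y x \<and> a = F y"] ordinal_mem[OF assms(2)] by blast
  qed
  moreover have "definable_fun G"
    unfolding G_def by (intro definable_intros definable_term_subst1[OF assms(1)])
  ultimately show ?thesis
    by (intro embedsI[of G]) (auto simp: inj_on_def, metis)
qed

section \<open>Ordinals that do not inject into a given set\<close>

text \<open>The relation transported along \<open>f\<close> is the reflexive one. With the strict order, the
  ordinals \<open>0\<close> and \<open>1\<close> would both give the empty relation, and \<open>x\<close> could not be recovered
  from \<open>r\<close>.\<close>

definition transports_order :: "'a \<Rightarrow> 'a \<Rightarrow> 'a \<Rightarrow> bool" where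
  "transports_order f x r \<longleftrightarrow> inj_on (app f) (ext x) \<and>
    (\<forall>p. E p r \<longleftrightarrow> (\<exists>y z. E y x \<and> E z x \<and> (E y z \<or> y = z) \<and> p = opair (app f y) (app f z)))"

text \<open>The composite of \<open>f\<close> with the inverse of \<open>f'\<close> preserves \<open>\<in>\<close>, so by induction it fixes
  every element: \<open>y\<close> and \<open>y'\<close> have the same elements.\<close>

lemma transported_order_agrees:
  assumes "ordinal x" "ordinal x'" "transports_order f x r" "transports_order f' x' r"
    "E y x" "E y' x'" "app f y = app f' y'"
  shows "y = y'"
proof -
  have inj: "inj_on (app f) (ext x)" "inj_on (app f') (ext x')"
    using assms(3,4) by (auto simp: transports_order_def)
  have r: "E (opair a b) r \<longleftrightarrow> (\<exists>y z. E y x \<and> E z x \<and> (E y z \<or> y = z) \<and> a = app f y \<and> b = app f z)"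
      for a b
    using assms(3) by (simp add: transports_order_def)
  have r': "E (opair a b) r \<longleftrightarrow>
      (\<exists>y z. E y x' \<and> E z x' \<and> (E y z \<or> y = z) \<and> a = app f' y \<and> b = app f' z)" for a b
    using assms(4) by (simp add: transports_order_def)
  have eq: "u = v" if "app f u = app f v" "E u x" "E v x" for u v
    using inj(1) that by (auto dest: inj_onD)
  have eq': "u = v" if "app f' u = app f' v" "E u x'" "E v x'" for u v
    using inj(2) that by (auto dest: inj_onD)
  have "\<forall>y'. E y x \<longrightarrow> E y' x' \<longrightarrow> app f y = app f' y' \<longrightarrow> y = y'"
    using ordinal_mem[OF assms(1,5)]
  proof (rule ordinal_induct)
    show "definable (\<lambda>s. \<forall>y'. E (s 0) x \<longrightarrow> E y' x' \<longrightarrow> app f (s 0) = app f' y' \<longrightarrow> s 0 = y')"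
      by (intro definable_intros)
  next
    fix y assume IH: "\<And>z. E z y \<Longrightarrow> \<forall>y'. E z x \<longrightarrow> E y' x' \<longrightarrow> app f z = app f' y' \<longrightarrow> z = y'"
    show "\<forall>y'. E y x \<longrightarrow> E y' x' \<longrightarrow> app f y = app f' y' \<longrightarrow> y = y'"
    proof (intro allI impI extensionality iffI)
      fix y' z assume y: "E y x" "E y' x'" "app f y = app f' y'" and z: "E z y"
      have zx: "E z x" using ordinal_trans[OF assms(1) y(1) z] .
      then have "E (opair (app f z) (app f y)) r" using r y z by blast
      then obtain u v where uv: "E u x'" "E v x'" "E u v \<or> u = v" "app f z = app f' u"
          "app f y = app f' v"
        using r' by blast
      have "v = y'" using eq' uv y by simp
      have "u \<noteq> v" using uv eq[of z y] zx y(1) z by auto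
      then show "E z y'" using uv \<open>v = y'\<close> IH[OF z] zx by auto
    next
      fix y' z assume y: "E y x" "E y' x'" "app f y = app f' y'" and z: "E z y'"
      have zx: "E z x'" using ordinal_trans[OF assms(2) y(2) z] .
      then have "E (opair (app f' z) (app f' y')) r" using r' y z by blast
      then obtain u v where uv: "E u x" "E v x" "E u v \<or> u = v" "app f' z = app f u"
          "app f' y' = app f v"
        using r by blast
      have "v = y" using eq uv y by simp
      have "u \<noteq> v" using uv eq'[of z y'] zx y(2) z by auto
      then show "E z y" using uv \<open>v = y\<close> IH[of u] zx by auto
    qed
  qed
  then show ?thesis using assms(5-7) by blast
qed

lemma transported_order_unique:
  assumes "ordinal x" "ordinal x'" "transports_order f x r" "transports_order f' x' r"
  shows "x = x'"
proof -
  have "E y x'" if *: "ordinal x" "ordinal x'" "transports_order f x r" "transports_order f' x' r"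
    "E y x" for x x' y f f'
  proof -
    have "E (opair (app f y) (app f y)) r"
      using *(3,5) unfolding transports_order_def by blast
    then obtain y' where "E y' x'" "app f y = app f' y'"
      using *(4) unfolding transports_order_def by auto
    then show ?thesis using transported_order_agrees[OF *, of y'] by simp
  qed
  then show ?thesis using assms by (intro extensionality) blast
qed

text \<open>If all ordinals injected into \<open>m\<close>, each would be the order type of a relation on \<open>m\<close>.
  Order types being unique, Replacement on the power set of \<open>m \<times> m\<close> would make the class of all
  ordinals a set, hence an ordinal that is an element of itself.\<close>

lemma hartogs: "\<exists>x. ordinal x \<and> \<not> embeds (ext x) (ext m)"
proof (rule ccontr)
  assume "\<not> ?thesis"
  then have all: "embeds (ext x) (ext m)" if "ordinal x" for x
    using that by blast
  \<comment> \<open>\<open>T r\<close> is the order type of \<open>r\<close>.\<close>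
  define T where "T r = the1 (\<lambda>x. ordinal x \<and> (\<exists>f. transports_order f x r))" for r
  define W where "W = {r. ext r \<subseteq> oprod (ext m) (ext m)}"
  have T: "T r = x" if "ordinal x" "transports_order f x r" for x f r
    unfolding T_def using that transported_order_unique by (intro the1_eqI) blast+
  have "x \<in> T ` W" if x: "ordinal x" for x
  proof -
    obtain f where f: "inj_on (app f) (ext x)" "app f ` ext x \<subseteq> ext m"
      using all[OF x] by (auto simp: embeds_iff_app)
    define A where "A = {p \<in> oprod (ext m) (ext m).
      \<exists>y z. E y x \<and> E z x \<and> (E y z \<or> y = z) \<and> p = opair (app f y) (app f z)}"
    have "isset A"
      unfolding A_def by (intro isset_sep isset_oprod isset_ext definable_intros)
    moreover have "opair (app f y) (app f z) \<in> oprod (ext m) (ext m)" if "E y x" "E z x" for y z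
      using that subsetD[OF f(2), of "app f y"] subsetD[OF f(2), of "app f z"]
      by (auto simp: oprod_def)
    ultimately have "transports_order f x (code A)" "code A \<in> W"
      using f(1) by (auto simp: transports_order_def mem_code W_def ext_code A_def)
    then show ?thesis using T[OF x] by blast
  qed
  moreover have "isset (T ` W)"
  proof (rule isset_image)
    show "isset W" unfolding W_def by (intro isset_Pow isset_oprod isset_ext)
    show "definable_fun T" unfolding T_def transports_order_def by (intro definable_intros)
  qed
  ultimately have "{x \<in> T ` W. ordinal x} = {x. ordinal x}" "isset {x \<in> T ` W. ordinal x}"
    by (auto intro!: isset_sep definable_intros)
  then have "isset {x. ordinal x}" by simp
  then have "ordinal (code {x. ordinal x})"
    by (rule ordinal_code) (auto dest: ordinal_mem)
  then have "E (code {x. ordinal x}) (code {x. ordinal x})"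
    by (subst mem_code[OF \<open>isset {x. ordinal x}\<close>]) simp
  then show False by simp
qed

end

section \<open>Recursion along well-orderings\<close>

text \<open>Minimal elements are required for the subsets that are sets of the model, which is all that
  Foundation provides.\<close>

locale internal_wellorder = ZF_model E for E :: "'a \<Rightarrow> 'a \<Rightarrow> bool" +
  fixes A :: "'a set" and R :: "'a \<Rightarrow> 'a \<Rightarrow> bool"
  assumes isset_A: "isset A"
    and definable_R: "definable (\<lambda>s. R (s 0) (s (Suc 0)))"
    and irrefl_R: "x \<in> A \<Longrightarrow> \<not> R x x"
    and trans_R: "x \<in> A \<Longrightarrow> y \<in> A \<Longrightarrow> z \<in> A \<Longrightarrow> R x y \<Longrightarrow> R y z \<Longrightarrow> R x z"
    and total_R: "x \<in> A \<Longrightarrow> y \<in> A \<Longrightarrow> R x y \<or> x = y \<or> R y x"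
    and minimal_R: "isset B \<Longrightarrow> B \<subseteq> A \<Longrightarrow> B \<noteq> {} \<Longrightarrow> \<exists>x\<in>B. \<forall>y\<in>B. \<not> R y x"
begin

lemmas definable_rel = definable_subst2[of R, OF definable_R]

lemma wf_induct:
  assumes "x \<in> A" "definable (\<lambda>s. P (s 0))"
    "\<And>x. x \<in> A \<Longrightarrow> (\<And>y. y \<in> A \<Longrightarrow> R y x \<Longrightarrow> P y) \<Longrightarrow> P x"
  shows "P x"
proof (rule ccontr)
  assume "\<not> P x"
  then have "{x \<in> A. \<not> P x} \<noteq> {}" using assms(1) by blast
  with minimal_R[OF isset_sep[OF isset_A definable_not[OF assms(2)]]]
  obtain y where "y \<in> A" "\<not> P y" "\<And>z. z \<in> A \<Longrightarrow> R z y \<Longrightarrow> P z" by auto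
  then show False using assms(3) by blast
qed

lemma isset_predecessors: "isset {y \<in> A. R y x}"
  by (intro isset_sep isset_A definable_rel definable_intros)

text \<open>The value at \<open>x\<close> may depend on the set of earlier values. An approximation up to \<open>x\<close> is a
  coded function that satisfies the recursion equation at \<open>x\<close> and at all predecessors of \<open>x\<close>;
  approximations agree wherever they overlap, so \<open>F x\<close> can be defined as their common value.\<close>

theorem recursion:
  assumes H: "definable_fun H"
  obtains F where "definable_fun F" "\<And>x. x \<in> A \<Longrightarrow> F x = H (code (F ` {y \<in> A. R y x}))"
proof -
  define pred where "pred x = {y \<in> A. R y x}" for x
  define approx where "approx g x \<longleftrightarrow>
    (\<forall>y. y \<in> A \<longrightarrow> y = x \<or> R y x \<longrightarrow> app g y = H (code ((\<lambda>z. app g z) ` {z. z \<in> A \<and> R z y})))" for g x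
  define F where "F x = the1 (\<lambda>v. \<exists>g. approx g x \<and> v = app g x)" for x
  note dintros = definable_intros definable_isset[OF isset_A] definable_rel
    definable_term_subst1[of H, OF H]
  have approx_iff: "approx g x \<longleftrightarrow>
      (\<forall>y\<in>A. y = x \<or> R y x \<longrightarrow> app g y = H (code (app g ` pred y)))" for g x
    by (auto simp: approx_def pred_def)
  have down: "approx g y" if "approx g x" "x \<in> A" "y \<in> A" "R y x" for g x y
    using that trans_R unfolding approx_iff by blast
  have unique: "app g x = app g' x" if "x \<in> A" "approx g x" "approx g' x" for g g' x
  proof -
    have "approx g x \<longrightarrow> approx g' x \<longrightarrow> app g x = app g' x"
      using \<open>x \<in> A\<close>
    proof (rule wf_induct)
      show "definable (\<lambda>s. approx g (s 0) \<longrightarrow> approx g' (s 0) \<longrightarrow> app g (s 0) = app g' (s 0))"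
        unfolding approx_def by (intro dintros)
    next
      fix x assume x: "x \<in> A"
        and IH: "\<And>y. y \<in> A \<Longrightarrow> R y x \<Longrightarrow> approx g y \<longrightarrow> approx g' y \<longrightarrow> app g y = app g' y"
      show "approx g x \<longrightarrow> approx g' x \<longrightarrow> app g x = app g' x"
      proof (intro impI)
        assume g: "approx g x" "approx g' x"
        then have "app g ` pred x = app g' ` pred x"
          using IH down[OF _ x] by (intro image_cong) (auto simp: pred_def)
        then show "app g x = app g' x"
          using g x unfolding approx_iff by metis
      qed
    qed
    then show ?thesis using that by blast
  qed
  have F_app: "F x = app g x" if "x \<in> A" "approx g x" for g x
    unfolding F_def using that unique by (intro the1_eqI) blast+
  have F_rec: "F x = H (code (F ` pred x))" if "x \<in> A" "approx g x" for g x
  proof -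
    have "F ` pred x = app g ` pred x"
      using F_app down[OF that(2,1)] by (intro image_cong) (auto simp: pred_def)
    then show ?thesis using F_app[OF that] that unfolding approx_iff by metis
  qed
  have F_def': "definable_fun F"
    unfolding F_def approx_def by (intro dintros)
  have ex: "\<exists>g. approx g x" if "x \<in> A" for x
    using that
  proof (rule wf_induct)
    show "definable (\<lambda>s. \<exists>g. approx g (s 0))"
      unfolding approx_def by (intro dintros)
  next
    fix x assume x: "x \<in> A" and IH: "\<And>y. y \<in> A \<Longrightarrow> R y x \<Longrightarrow> \<exists>g. approx g y"
    \<comment> \<open>Below \<open>x\<close> the function \<open>F\<close> already has its final values; one more value is added.\<close>
    define F' where "F' z = (if z = x then H (code (F ` {y. y \<in> A \<and> R y x})) else F z)" for z
    define g where "g = graph F' A"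
    have "definable_fun F'"
      unfolding F'_def by (intro dintros definable_term_subst1[of F, OF F_def'])
    then have g: "app g z = F' z" if "z \<in> A" for z
      unfolding g_def using app_graph[OF isset_A _ that] by blast
    have g': "app g ` pred y = F ` pred y" if "y \<in> A" "y = x \<or> R y x" for y
    proof (rule image_cong)
      fix z assume "z \<in> pred y"
      then have "z \<in> A" "z \<noteq> x"
        using that irrefl_R[OF x] trans_R[OF x that(1) x] by (auto simp: pred_def)
      then show "app g z = F z" using g by (simp add: F'_def)
    qed simp
    have "app g y = H (code (app g ` pred y))" if y: "y \<in> A" "y = x \<or> R y x" for y
    proof (cases "y = x")
      case True
      then show ?thesis using g[OF x] g'[OF y] by (simp add: F'_def pred_def)
    next
      case False
      then obtain h where "approx h y" using IH y by blast
      then show ?thesis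
        using F_rec[OF y(1)] g'[OF y] g[OF y(1)] False by (simp add: F'_def)
    qed
    then show "\<exists>g. approx g x" unfolding approx_iff by blast
  qed
  then have "F x = H (code (F ` pred x))" if "x \<in> A" for x using F_rec that by blast
  then show ?thesis using that[OF F_def'] unfolding pred_def by blast
qed

text \<open>The Mostowski collapse: recursion with the identity sends each element to the set of values
  at its predecessors. Transitivity of \<open>R\<close> makes all values transitive sets, hence ordinals.\<close>

theorem collapse:
  obtains F x where "definable_fun F" "ordinal x" "bij_betw F A (ext x)"
    "\<And>a. a \<in> A \<Longrightarrow> ext (F a) = F ` {b \<in> A. R b a}"
proof -
  obtain F where F: "definable_fun F" and rec: "\<And>x. x \<in> A \<Longrightarrow> F x = code (F ` {y \<in> A. R y x})"
    by (rule recursion[of "\<lambda>x. x", OF definable_term_var]) (rule that)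
  have ext_F: "ext (F x) = F ` {y \<in> A. R y x}" if "x \<in> A" for x
    unfolding rec[OF that] by (intro ext_code isset_image F isset_predecessors)
  then have mem_F: "E z (F x) \<longleftrightarrow> (\<exists>y\<in>A. R y x \<and> z = F y)" if "x \<in> A" for x z
    using that by (auto simp: set_eq_iff image_iff)
  have trans: "transitive (F x)" if x: "x \<in> A" for x
    unfolding transitive_def
  proof (intro allI impI)
    fix v w assume "E v (F x)" "E w v"
    then obtain y where y: "y \<in> A" "R y x" "E w (F y)"
      using iffD1[OF mem_F[OF x]] by auto
    then obtain z where z: "z \<in> A" "R z y" "w = F z"
      using iffD1[OF mem_F[OF y(1)] y(3)] by auto
    then have "R z x" using trans_R[OF z(1) y(1) x] y(2) by blast
    then show "E w (F x)" using iffD2[OF mem_F[OF x], of w] z by auto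
  qed
  have "ordinal (F x)" if "x \<in> A" for x
    unfolding ordinal_def using trans mem_F[OF that] that by auto
  moreover have isset: "isset (F ` A)" by (intro isset_image isset_A F)
  ultimately have "ordinal (code (F ` A))"
    by (intro ordinal_code) (auto simp: mem_F)
  moreover have "inj_on F A"
  proof (rule inj_onI, rule ccontr)
    fix x y assume "x \<in> A" "y \<in> A" "F x = F y" "x \<noteq> y"
    then have "E (F x) (F y) \<or> E (F y) (F x)"
      using total_R[of x y] mem_F[of x "F y"] mem_F[of y "F x"] by auto
    then show False using \<open>F x = F y\<close> by simp
  qed
  ultimately show ?thesis
    using that[OF F _ _ ext_F] isset by (auto simp: bij_betw_def ext_code)
qed

end

context ZF_model begin

lemma internal_wellorder_ordinal:
  assumes "ordinal x" "isset A" "A \<subseteq> ext x"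
  shows "internal_wellorder E A E"
proof
  show "definable (\<lambda>s. E (s 0) (s (Suc 0)))" by (rule definable_mem_var)
  have ord: "ordinal a" if "a \<in> A" for a
    using that assms(3) ordinal_mem[OF assms(1)] by auto
  show "E a c" if "c \<in> A" "E a b" "E b c" for a b c
    using ordinal_trans[OF ord[OF that(1)] that(3,2)] .
  show "E a b \<or> a = b \<or> E b a" if "a \<in> A" "b \<in> A" for a b
    using ordinal_linear ord that by blast
  show "\<exists>x\<in>B. \<forall>y\<in>B. \<not> E y x" if "isset B" "B \<noteq> {}" for B
    using foundation_set[OF that] by metis
qed (use assms in auto)

section \<open>Choice and injections into ordinals\<close>

text \<open>Let \<open>k\<close> be the least ordinal into which \<open>S\<close> injects. The image of \<open>S\<close> in \<open>k\<close> collapses to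
  an ordinal \<open>c\<close>. Minimality excludes \<open>c \<in> k\<close>, and \<open>k \<in> c\<close> would make \<open>k\<close> the collapse of a
  proper initial segment, hence inject it into an element of \<open>k\<close>. So \<open>c = k\<close>.\<close>

lemma bij_least_ordinal:
  assumes "isset S" "ordinal x" "embeds S (ext x)"
  obtains k F where "ordinal k" "definable_fun F" "bij_betw F S (ext k)"
    "\<And>y. E y k \<Longrightarrow> \<not> embeds S (ext y)"
proof -
  have "definable (\<lambda>s. embeds S (ext (s 0)))"
    by (intro definable_embeds assms(1) definable_intros definable_isset[OF assms(1)])
  from ordinal_least[OF assms(2), of "\<lambda>x. embeds S (ext x)", OF assms(3) this]
  obtain k where k: "ordinal k" "embeds S (ext k)" "\<And>y. E y k \<Longrightarrow> \<not> embeds S (ext y)"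
    by blast
  obtain F where F: "definable_fun F" "inj_on F S" "F ` S \<subseteq> ext k"
    using k(2) by (auto simp: embeds_def)
  interpret internal_wellorder E "F ` S" E
    by (rule internal_wellorder_ordinal[OF k(1) isset_image[OF assms(1) F(1)] F(3)])
  obtain C c where C: "definable_fun C" "ordinal c" "bij_betw C (F ` S) (ext c)"
    "\<And>a. a \<in> F ` S \<Longrightarrow> ext (C a) = C ` {b \<in> F ` S. E b a}"
    by (rule collapse) (rule that)
  have CF: "definable_fun (\<lambda>a. C (F a))" "bij_betw (\<lambda>a. C (F a)) S (ext c)"
    using definable_fun_comp[OF F(1) C(1)]
      bij_betw_trans[of F S "F ` S" C, OF inj_on_imp_bij_betw[OF F(2)] C(3)]
    by (simp_all add: comp_def)
  have "embeds S (ext c)"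
    using CF by (intro embedsI[OF CF(1)]) (auto simp: bij_betw_def)
  then have "\<not> E c k" using k(3) by blast
  moreover have "\<not> E k c"
  proof
    assume "E k c"
    then have "k \<in> C ` F ` S" using bij_betw_imp_surj_on[OF C(3)] by simp
    then obtain a where a: "a \<in> F ` S" "k = C a" by blast
    then have "ext k \<subseteq> C ` ext a" using C(4)[OF a(1)] by auto
    moreover have "E a k" using a(1) F(3) by auto
    moreover have "embeds (ext k) (ext a)"
      by (rule embeds_if_surj[OF C(1) ordinal_mem[OF k(1) \<open>E a k\<close>] \<open>ext k \<subseteq> C ` ext a\<close>])
    ultimately show False using k(2,3) embeds_trans by blast
  qed
  ultimately have "c = k" using ordinal_linear[OF C(2) k(1)] by blast
  then show ?thesis using that[OF k(1) CF(1)] CF(2) k(3) by blast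
qed

text \<open>Two sets that inject into each other have the same least ordinal, and both are equinumerous
  to it.\<close>

lemma equinumerous_if_embeds:
  assumes "embeds (ext x) (ext y)" "embeds (ext y) (ext x)" "ordinal a" "embeds (ext x) (ext a)"
  shows "equinumerous E x y"
proof -
  obtain k F where k: "ordinal k" "definable_fun F" "bij_betw F (ext x) (ext k)"
    "\<And>z. E z k \<Longrightarrow> \<not> embeds (ext x) (ext z)"
    using bij_least_ordinal[OF isset_ext assms(3,4)] by metis
  obtain l G where l: "ordinal l" "definable_fun G" "bij_betw G (ext y) (ext l)"
    "\<And>z. E z l \<Longrightarrow> \<not> embeds (ext y) (ext z)"
    using bij_least_ordinal[OF isset_ext assms(3) embeds_trans[OF assms(2,4)]] by metis
  have xk: "equinumerous E x k" and yl: "equinumerous E y l"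
    using k(2,3) l(2,3) by (auto simp: equinumerous_iff)
  have "\<not> E l k"
    using k(4) embeds_trans[OF assms(1) embeds_if_equinumerous[OF yl]] by blast
  moreover have "\<not> E k l"
    using l(4) embeds_trans[OF assms(2) embeds_if_equinumerous[OF xk]] by blast
  ultimately have "k = l" using ordinal_linear[OF k(1) l(1)] by blast
  then show ?thesis
    using equinumerous_trans[OF xk] equinumerous_sym[OF yl] by blast
qed

lemma choice_function:
  assumes "axiom_of_choice E"
  shows "\<exists>c. \<forall>y. ext y \<subseteq> ext m \<longrightarrow> y \<noteq> zero \<longrightarrow> E (app c y) y"
proof -
  define P where "P = {y \<in> {y. ext y \<subseteq> ext m}. y \<noteq> zero}"
  have P: "isset P"
    unfolding P_def by (intro isset_sep isset_Pow isset_ext definable_intros)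
  have "\<exists>z. E z y" if "y \<noteq> zero" for y
    using that extensionality[of y zero] by auto
  then have *: "\<forall>y. E y (code P) \<longrightarrow> (\<exists>z. E z y)"
    unfolding mem_code[OF P] by (simp add: P_def)
  from assms[unfolded axiom_of_choice_def is_opair_iff maps_iff, THEN spec, THEN mp, OF *]
  obtain c where c: "\<And>p. E p c \<Longrightarrow> \<exists>y z. E z y \<and> p = opair y z"
    "\<And>y. y \<in> P \<Longrightarrow> \<exists>!z. E (opair y z) c"
    unfolding mem_code[OF P] by blast
  have "E (app c y) y" if "y \<in> P" for y
  proof -
    have "E (opair y (app c y)) c" unfolding app_def by (rule the1I[OF c(2)[OF that]])
    from c(1)[OF this] show ?thesis by auto
  qed
  then show ?thesis by (auto simp: P_def)
qed

text \<open>Zermelo's argument: enumerate \<open>m\<close> along an ordinal \<open>h\<close> that does not inject into it, choosing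
  at each stage an element not yet listed. The enumeration cannot stay injective on all of \<open>h\<close>,
  so \<open>m\<close> is exhausted at some stage \<open>x\<close>.\<close>

theorem embeds_ordinal_if_choice:
  assumes "axiom_of_choice E"
  shows "\<exists>x. ordinal x \<and> embeds (ext m) (ext x)"
proof -
  obtain c where c: "\<And>y. ext y \<subseteq> ext m \<Longrightarrow> y \<noteq> zero \<Longrightarrow> E (app c y) y"
    using choice_function[OF assms] by blast
  obtain h where h: "ordinal h" "\<not> embeds (ext h) (ext m)"
    using hartogs by blast
  interpret internal_wellorder E "ext h" E
    by (rule internal_wellorder_ordinal[OF h(1) isset_ext subset_refl])
  define rest where "rest y = code {z. E z m \<and> \<not> E z y}" for y
  have rest_def': "definable_fun rest"
    unfolding rest_def by (intro definable_intros)
  have "isset {z \<in> ext m. \<not> E z y}" for y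
    by (intro isset_sep isset_ext definable_intros)
  then have rest: "E z (rest y) \<longleftrightarrow> E z m \<and> \<not> E z y" for y z
    unfolding rest_def by (subst mem_code) simp_all
  have "definable_fun (\<lambda>y. app c (rest y))"
    by (intro definable_intros definable_term_subst1[OF rest_def'])
  from recursion[OF this] obtain F where F: "definable_fun F"
    "\<And>x. x \<in> ext h \<Longrightarrow> F x = app c (rest (code (F ` {y \<in> ext h. E y x})))" by blast
  have new: "F x \<in> ext m - F ` ext x" if x: "E x h" "\<not> ext m \<subseteq> F ` ext x" for x
  proof -
    have "{y \<in> ext h. E y x} = ext x" using ordinal_trans[OF h(1) x(1)] by auto
    then have eq: "F x = app c (rest (code (F ` ext x)))" using F(2)[of x] x(1) by simp
    have mem: "E z (rest (code (F ` ext x))) \<longleftrightarrow> E z m \<and> z \<notin> F ` ext x" for z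
      unfolding rest by (subst mem_code[OF isset_image[OF isset_ext F(1)]]) simp
    have "rest (code (F ` ext x)) \<noteq> zero"
      using x(2) mem not_mem_zero by (metis mem_ext subsetI)
    then have "E (F x) (rest (code (F ` ext x)))"
      unfolding eq using mem by (intro c) auto
    then show ?thesis unfolding mem by simp
  qed
  show ?thesis
  proof (cases "\<exists>x. E x h \<and> ext m \<subseteq> F ` ext x")
    case True
    then obtain x where "E x h" "ext m \<subseteq> F ` ext x" by blast
    then show ?thesis
      using embeds_if_surj[OF F(1) ordinal_mem[OF h(1)]] ordinal_mem[OF h(1)] by blast
  next
    case False
    have "inj_on F (ext h)"
    proof (rule inj_onI, rule ccontr)
      fix x y assume xy: "x \<in> ext h" "y \<in> ext h" "F x = F y" "x \<noteq> y"
      then have "x \<in> ext y \<or> y \<in> ext x" using total_R[of x y] by auto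
      moreover have "F x \<notin> F ` ext x" "F y \<notin> F ` ext y"
        using new[of x] new[of y] False xy by auto
      ultimately show False using xy(3) by (metis imageI)
    qed
    moreover have "F ` ext h \<subseteq> ext m" using new False by fastforce
    ultimately show ?thesis using h(2) F(1) by (auto simp: embeds_def)
  qed
qed

text \<open>One injection of the union of the family into an ordinal suffices to choose the least element of
  every member.\<close>

theorem choice_if_embeds_ordinal:
  assumes "\<And>m. \<exists>x. ordinal x \<and> embeds (ext m) (ext x)"
  shows "axiom_of_choice E"
  unfolding axiom_of_choice_def is_opair_iff maps_iff
proof (intro allI impI)
  fix x assume nonempty: "\<forall>y. E y x \<longrightarrow> (\<exists>z. E z y)"
  define U where "U = (\<Union>y\<in>ext x. ext y)"
  have U: "isset U" unfolding U_def by (intro isset_Union isset_ext)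
  obtain a where a: "ordinal a" "embeds U (ext a)"
    using assms[of "code U"] ext_code[OF U] by auto
  then obtain F where F: "definable_fun F" "inj_on F U" "F ` U \<subseteq> ext a"
    by (auto simp: embeds_def)
  define least where "least y = least_ordinal (\<lambda>b. \<exists>z. E z y \<and> b = F z)" for y
  define c where "c y = the1 (\<lambda>z. E z y \<and> F z = least y)" for y
  have least_def': "definable_fun least"
    unfolding least_def by (intro definable_intros definable_term_subst1[OF F(1)])
  have c_def': "definable_fun c"
    unfolding c_def
    by (intro definable_intros definable_term_subst1[OF F(1)] definable_term_subst1[OF least_def'])
  have c: "E (c y) y" if y: "E y x" for y
  proof -
    have U': "z \<in> U" if "E z y" for z using y that by (auto simp: U_def)
    obtain z where z: "E z y" using nonempty y by blast
    have "ordinal (F z)" using F(3) U'[OF z] ordinal_mem[OF a(1)] by auto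
    moreover have "definable (\<lambda>s. \<exists>z. E z y \<and> s 0 = F z)"
      by (intro definable_intros definable_term_subst1[OF F(1)])
    ultimately have "\<exists>z. E z y \<and> least y = F z"
      unfolding least_def using least_ordinal(1)[of "F z" "\<lambda>b. \<exists>z. E z y \<and> b = F z"] z by blast
    then have "\<exists>!z. E z y \<and> F z = least y"
      using inj_onD[OF F(2)] U' by metis
    from the1I[OF this] show ?thesis by (simp add: c_def)
  qed
  have graph: "E p (graph c (ext x)) \<longleftrightarrow> (\<exists>y. E y x \<and> p = opair y (c y))" for p
    using ext_graph[OF isset_ext c_def', of x] by (auto simp: set_eq_iff image_iff)
  show "\<exists>f. (\<forall>p. E p f \<longrightarrow> (\<exists>y z. E y x \<and> E z y \<and> p = opair y z)) \<and>
    (\<forall>y. E y x \<longrightarrow> (\<exists>!z. E (opair y z) f))"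
    by (rule exI[of _ "graph c (ext x)"]) (auto simp: graph c)
qed

section \<open>From the cardinal equations to choice\<close>

definition two_subsets :: "'a set \<Rightarrow> 'a set" where
  "two_subsets A = {upair a b | a b. a \<in> A \<and> b \<in> A \<and> a \<noteq> b}"

lemma is_two_subsets_iff: "is_two_subsets E m p \<longleftrightarrow> ext p = two_subsets (ext m)"
  unfolding is_two_subsets_def is_upair_iff two_subsets_def set_eq_iff mem_ext mem_Collect_eq
  by (intro iff_allI arg_cong2[where f = "(=)"] refl) blast

lemma is_product_iff: "is_product E m n p \<longleftrightarrow> ext p = oprod (ext m) (ext n)"
  unfolding is_product_def is_opair_iff oprod_def set_eq_iff mem_ext mem_Collect_eq
  by (intro iff_allI arg_cong2[where f = "(=)"] refl) blast

lemma isset_two_subsets [intro]: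
  assumes "isset A"
  shows "isset (two_subsets A)"
proof -
  have "isset ((\<lambda>q. upair (ofst q) (osnd q)) ` {q \<in> oprod A A. ofst q \<noteq> osnd q})"
    by (intro isset_image isset_sep isset_oprod assms definable_intros)
  moreover have "(\<lambda>q. upair (ofst q) (osnd q)) ` {q \<in> oprod A A. ofst q \<noteq> osnd q} = two_subsets A"
    by (force simp: two_subsets_def oprod_def)
  ultimately show ?thesis by simp
qed

definition osum :: "'a set \<Rightarrow> 'a set \<Rightarrow> 'a set" where
  "osum A B = oprod {zero} A \<union> oprod {succ zero} B"

lemma zero_neq_succ [simp]: "zero \<noteq> succ x" "succ x \<noteq> zero"
  using mem_succ[of x x] not_mem_zero by metis+

lemma isset_osum [intro]: "isset A \<Longrightarrow> isset B \<Longrightarrow> isset (osum A B)"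
  unfolding osum_def by (intro isset_Un isset_oprod isset_singleton)

lemma mem_osum [simp]:
  "opair zero a \<in> osum A B \<longleftrightarrow> a \<in> A" "opair (succ zero) b \<in> osum A B \<longleftrightarrow> b \<in> B"
  by (auto simp: osum_def oprod_def)

lemma osum_cases:
  assumes "p \<in> osum A B"
  obtains a where "a \<in> A" "p = opair zero a" | b where "b \<in> B" "p = opair (succ zero) b"
  using assms by (auto simp: osum_def oprod_def)

lemma embeds_two_subsets_osum: "embeds (oprod A B) (two_subsets (osum A B))"
proof (rule embedsI)
  let ?F = "\<lambda>p. upair (opair zero (ofst p)) (opair (succ zero) (osnd p))"
  show "definable_fun ?F" by (intro definable_intros)
  show "inj_on ?F (oprod A B)"
    by (auto simp: inj_on_def oprod_def upair_eq_iff doubleton_eq_iff)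
  show "?F ` oprod A B \<subseteq> two_subsets (osum A B)"
    unfolding two_subsets_def
  proof (intro subsetI)
    fix q assume "q \<in> ?F ` oprod A B"
    then obtain a b where "a \<in> A" "b \<in> B" "q = upair (opair zero a) (opair (succ zero) b)"
      by (auto simp: oprod_def)
    moreover have "opair zero a \<noteq> opair (succ zero) b" by simp
    ultimately show "q \<in> {upair a b | a b. a \<in> osum A B \<and> b \<in> osum A B \<and> a \<noteq> b}"
      using mem_osum by blast
  qed
qed

lemma embeds_oprod_osum: "embeds (oprod A B) (oprod (osum A B) (osum A B))"
proof (rule embedsI)
  let ?F = "\<lambda>p. opair (opair zero (ofst p)) (opair (succ zero) (osnd p))"
  show "definable_fun ?F" by (intro definable_intros)
  show "inj_on ?F (oprod A B)" by (auto simp: inj_on_def oprod_def)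
  show "?F ` oprod A B \<subseteq> oprod (osum A B) (osum A B)"
    unfolding oprod_def[of "osum A B"] by (auto simp: oprod_def)
qed

text \<open>If some fibre \<open>{a} \<times> h\<close> were mapped into the copy of \<open>A\<close>, then \<open>h\<close> would inject into \<open>A\<close>.
  So every fibre meets the copy of \<open>h\<close>, and the first meeting point determines \<open>a\<close>.\<close>

lemma tarski_comparison:
  assumes "isset A" "ordinal h" "\<not> embeds (ext h) A"
    "embeds (oprod A (ext h)) (osum A (ext h))"
  shows "embeds A (ext h)"
proof -
  obtain F where F: "definable_fun F" "inj_on F (oprod A (ext h))"
    "F ` oprod A (ext h) \<subseteq> osum A (ext h)"
    using assms(4) by (auto simp: embeds_def)
  define least where
    "least a = least_ordinal (\<lambda>b. E b h \<and> ofst (F (opair a b)) = succ zero)" for a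
  define G where "G a = osnd (F (opair a (least a)))" for a
  have in_prod: "opair a b \<in> oprod A (ext h)" if "a \<in> A" "E b h" for a b
    using that by (auto simp: oprod_def)
  have in_sum: "F (opair a b) \<in> osum A (ext h)" if "a \<in> A" "E b h" for a b
    using in_prod[OF that] F(3) by blast
  have injF: "a = a' \<and> b = b'"
    if "a \<in> A" "E b h" "a' \<in> A" "E b' h" "F (opair a b) = F (opair a' b')" for a b a' b'
    using inj_onD[OF F(2) that(5) in_prod[OF that(1,2)] in_prod[OF that(3,4)]] by simp
  have hit: "\<exists>b. E b h \<and> ofst (F (opair a b)) = succ zero" if a: "a \<in> A" for a
  proof (rule ccontr)
    assume no: "\<not> ?thesis"
    have left: "osnd (F (opair a b)) \<in> A \<and> F (opair a b) = opair zero (osnd (F (opair a b)))"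
      if "E b h" for b
      using in_sum[OF a that] no that by (auto elim!: osum_cases)
    have "embeds (ext h) A"
    proof (rule embedsI)
      show "definable_fun (\<lambda>b. osnd (F (opair a b)))"
        by (intro definable_intros definable_term_subst1[OF F(1)])
      show "inj_on (\<lambda>b. osnd (F (opair a b))) (ext h)"
      proof (rule inj_onI)
        fix b b' assume "b \<in> ext h" "b' \<in> ext h" "osnd (F (opair a b)) = osnd (F (opair a b'))"
        then have "E b h" "E b' h" "F (opair a b) = F (opair a b')"
          using left[of b] left[of b'] by auto
        then show "b = b'" using injF a by blast
      qed
      show "(\<lambda>b. osnd (F (opair a b))) ` ext h \<subseteq> A" using left by auto
    qed
    then show False using assms(3) by simp
  qed
  have least: "E (least a) h \<and> ofst (F (opair a (least a))) = succ zero" if a: "a \<in> A" for a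
  proof -
    obtain b where b: "E b h" "ofst (F (opair a b)) = succ zero" using hit[OF a] by blast
    have "definable (\<lambda>s. E (s 0) h \<and> ofst (F (opair a (s 0))) = succ zero)"
      by (intro definable_intros definable_term_subst1[OF F(1)])
    with b show ?thesis
      unfolding least_def
      using least_ordinal(1)[of b "\<lambda>b. E b h \<and> ofst (F (opair a b)) = succ zero"]
        ordinal_mem[OF assms(2)] by blast
  qed
  have G: "E (G a) h \<and> F (opair a (least a)) = opair (succ zero) (G a)" if a: "a \<in> A" for a
    using in_sum[OF a, of "least a"] least[OF a] by (auto simp: G_def elim!: osum_cases)
  show ?thesis
  proof (rule embedsI)
    have least_def': "definable_fun least"
      unfolding least_def by (intro definable_intros definable_term_subst1[OF F(1)])
    show "definable_fun G"
      unfolding G_def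
      by (intro definable_intros definable_term_subst1[OF F(1)] definable_term_subst1[OF least_def'])
    show "inj_on G A"
    proof (rule inj_onI)
      fix a a' assume a: "a \<in> A" "a' \<in> A" "G a = G a'"
      then have "F (opair a (least a)) = F (opair a' (least a'))" using G by simp
      then show "a = a'" using injF a least by blast
    qed
    show "G ` A \<subseteq> ext h" using G by auto
  qed
qed

text \<open>The disjunction may be resolved differently for different cardinals. This does no harm, since
  for each set a single instance is used and both cases give the same injection.\<close>

theorem choice_if_two_subsets_or_square:
  assumes "\<And>\<mm>. infinite_cardinal E \<mm> \<Longrightarrow>
    two_subsets_cardinal E \<mm> = \<mm> \<or> cardinal_mult E \<mm> \<mm> = \<mm>"
  shows "axiom_of_choice E"
proof (rule choice_if_embeds_ordinal)
  fix m
  define A where "A = ext m \<union> omega"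
  have A: "isset A" unfolding A_def by (intro isset_Un isset_ext isset_omega)
  obtain h where h: "ordinal h" "\<not> embeds (ext h) A"
    using hartogs[of "code A"] ext_code[OF A] by auto
  define n where "n = code (osum A (ext h))"
  have n: "ext n = osum A (ext h)"
    unfolding n_def by (intro ext_code isset_osum A isset_ext)
  have mem: "n \<in> cardinality E n" by (simp add: cardinality_def equinumerous_refl)
  have "embeds (ext h) (ext n)"
    unfolding n by (rule embedsI[of "opair (succ zero)"])
      (auto intro: definable_intros simp: inj_on_def)
  then have "\<not> equinumerous E n k" if "k \<in> omega" for k
    using h(2) embeds_trans embeds_if_equinumerous[of n k] embeds_subset[of "ext k" A]
      mem_natural[OF that] unfolding A_def by (metis (full_types) UnCI mem_ext subsetI)
  then have "infinite_cardinal E (cardinality E n)"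
    using mem unfolding infinite_cardinal_def is_cardinal_def omega_def cardinality_def by blast
  from assms[OF this] have "embeds (oprod A (ext h)) (ext n)"
  proof
    assume eq: "two_subsets_cardinal E (cardinality E n) = cardinality E n"
    define p where "p = code (two_subsets (ext n))"
    have p: "ext p = two_subsets (ext n)" unfolding p_def by (intro ext_code isset_two_subsets isset_ext)
    then have "cardinality E p \<subseteq> two_subsets_cardinal E (cardinality E n)"
      unfolding two_subsets_cardinal_def is_two_subsets_iff using mem by (intro Union_upper) blast
    then have "p \<in> two_subsets_cardinal E (cardinality E n)"
      using equinumerous_refl[of p] by (auto simp: cardinality_def[of E p])
    then have "equinumerous E p n" unfolding eq by (simp add: cardinality_def)
    then show ?thesis
      using embeds_trans[OF embeds_two_subsets_osum, of A "ext h" "ext n"]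
        embeds_if_equinumerous[of p n] by (simp add: p n)
  next
    assume eq: "cardinal_mult E (cardinality E n) (cardinality E n) = cardinality E n"
    define p where "p = code (oprod (ext n) (ext n))"
    have p: "ext p = oprod (ext n) (ext n)" unfolding p_def by (intro ext_code isset_oprod isset_ext)
    then have "cardinality E p \<subseteq> cardinal_mult E (cardinality E n) (cardinality E n)"
      unfolding cardinal_mult_def is_product_iff using mem by (intro Union_upper) blast
    then have "p \<in> cardinal_mult E (cardinality E n) (cardinality E n)"
      using equinumerous_refl[of p] by (auto simp: cardinality_def[of E p])
    then have "equinumerous E p n" unfolding eq by (simp add: cardinality_def)
    then show ?thesis
      using embeds_trans[OF embeds_oprod_osum, of A "ext h" "ext n"]
        embeds_if_equinumerous[of p n] by (simp add: p n)
  qed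
  then have "embeds A (ext h)"
    using tarski_comparison[OF A h] by (simp add: n)
  then show "\<exists>x. ordinal x \<and> embeds (ext m) (ext x)"
    using h(1) embeds_trans[OF embeds_subset[of "ext m" A]] unfolding A_def by blast
qed

section \<open>Finite sets\<close>

text \<open>Finiteness, stated by an injection instead of a bijection so that it passes to subsets at once.\<close>

definition bounded :: "'a set \<Rightarrow> bool" where
  "bounded A \<longleftrightarrow> (\<exists>n. n \<in> omega \<and> embeds A (ext n))"

lemma bounded_embeds: "embeds A B \<Longrightarrow> bounded B \<Longrightarrow> bounded A"
  using embeds_trans by (auto simp: bounded_def)

lemma bounded_empty: "bounded {}"
  unfolding bounded_def using embeds_subset[of "{}" "ext zero"] zero_in_omega by blast

lemma bounded_insert:
  assumes "bounded A"
  shows "bounded (insert a A)"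
proof -
  obtain n F where F: "n \<in> omega" "definable_fun F" "inj_on F A" "F ` A \<subseteq> ext n"
    using assms by (auto simp: bounded_def embeds_def)
  have "embeds (insert a A) (ext (succ n))"
  proof (rule embedsI)
    show "definable_fun (\<lambda>x. if x = a then n else F x)"
      by (intro definable_intros definable_term_subst1[OF F(2)])
    have "F x \<noteq> n" if "x \<in> A" for x using F(4) that not_mem_self[of n] by auto
    then show "inj_on (\<lambda>x. if x = a then n else F x) (insert a A)"
      using F(3) by (auto simp: inj_on_def)
    show "(\<lambda>x. if x = a then n else F x) ` insert a A \<subseteq> ext (succ n)"
      using F(4) by auto
  qed
  then show ?thesis using succ_in_omega[OF F(1)] by (auto simp: bounded_def)
qed

text \<open>Induction on the natural number that bounds the size: removing the element mapped to the
  largest value lowers the bound.\<close>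

lemma bounded_induct:
  assumes "bounded B" "isset B" "definable (\<lambda>s. P (s 0))" "P zero"
    "\<And>y z. P y \<Longrightarrow> P (code (insert z (ext y)))"
  shows "P (code B)"
proof -
  obtain n where n: "n \<in> omega" "embeds B (ext n)" using assms(1) by (auto simp: bounded_def)
  have "\<forall>y. embeds (ext y) (ext n) \<longrightarrow> P y"
    using n(1)
  proof (rule omega_induct)
    show "definable (\<lambda>s. \<forall>y. embeds (ext y) (ext (s 0)) \<longrightarrow> P y)"
      by (intro definable_intros isset_ext definable_subst1[OF assms(3)])
    show "\<forall>y. embeds (ext y) (ext zero) \<longrightarrow> P y"
    proof (intro allI impI)
      fix y assume "embeds (ext y) (ext zero)"
      then have "ext y = ext zero" by (auto simp: embeds_def)
      then show "P y" using assms(4) by (simp only: ext_inject)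
    qed
  next
    fix n assume IH: "\<forall>y. embeds (ext y) (ext n) \<longrightarrow> P y"
    show "\<forall>y. embeds (ext y) (ext (succ n)) \<longrightarrow> P y"
    proof (intro allI impI)
      fix y assume "embeds (ext y) (ext (succ n))"
      then obtain F where F: "definable_fun F" "inj_on F (ext y)" "F ` ext y \<subseteq> insert n (ext n)"
        by (auto simp: embeds_def)
      define y' where "y' = code {z \<in> ext y. F z \<noteq> n}"
      have y': "ext y' = {z \<in> ext y. F z \<noteq> n}"
        unfolding y'_def
        by (intro ext_code isset_sep isset_ext definable_intros definable_term_subst1[OF F(1)])
      have "embeds (ext y') (ext n)"
        using F(2,3) unfolding y'
        by (intro embedsI[OF F(1)]) (blast intro: inj_on_subset, blast)
      then have P: "P y'" using IH by blast
      show "P y"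
      proof (cases "n \<in> F ` ext y")
        case True
        then obtain z where "z \<in> ext y" "F z = n" by blast
        then have "ext y = insert z (ext y')"
          unfolding y' using F(2) by (auto dest: inj_onD)
        then have "y = code (insert z (ext y'))" using code_ext[of y] by simp
        then show ?thesis using assms(5)[OF P] by simp
      next
        case False
        then have "ext y = ext y'" unfolding y' by auto
        then show ?thesis using P by (simp only: ext_inject)
      qed
    qed
  qed
  then show ?thesis using n(2) ext_code[OF assms(2)] by simp
qed

lemma bounded_Un:
  assumes "isset A" "isset B" "bounded A" "bounded B"
  shows "bounded (A \<union> B)"
proof -
  have "bounded (A \<union> ext (code B))"
    using assms(4,2)
  proof (rule bounded_induct[where P = "\<lambda>y. bounded (A \<union> ext y)"])
    show "definable (\<lambda>s. bounded (A \<union> ext (s 0)))"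
      unfolding bounded_def
      by (intro definable_intros isset_Un isset_ext assms(1) definable_isset[OF isset_omega]
          definable_isset[OF assms(1)])
    show "bounded (A \<union> ext (code (insert z (ext y))))" if "bounded (A \<union> ext y)" for y z
      using bounded_insert[OF that, of z] by (simp add: ext_code isset_insert)
  qed (simp add: assms(3))
  then show ?thesis by (simp add: ext_code assms(2))
qed

lemma bounded_oprod:
  assumes "isset A" "isset B" "bounded A" "bounded B"
  shows "bounded (oprod A B)"
proof -
  have "bounded (oprod A (ext (code B)))"
    using assms(4,2)
  proof (rule bounded_induct[where P = "\<lambda>y. bounded (oprod A (ext y))"])
    show "definable (\<lambda>s. bounded (oprod A (ext (s 0))))"
      unfolding bounded_def
      by (intro definable_intros isset_oprod isset_ext assms(1) definable_isset[OF isset_omega]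
          definable_isset[OF assms(1)])
    have "oprod A {} = {}" by (simp add: oprod_def)
    then show "bounded (oprod A (ext zero))" by (simp add: bounded_empty)
    show "bounded (oprod A (ext (code (insert z (ext y)))))" if "bounded (oprod A (ext y))" for y z
    proof -
      have "embeds (oprod A {z}) A"
        by (rule embedsI[of ofst]) (auto intro: definable_intros simp: inj_on_def oprod_def)
      then have "bounded (oprod A {z})" using bounded_embeds assms(3) by blast
      then have "bounded (oprod A (ext y) \<union> oprod A {z})"
        by (intro bounded_Un isset_oprod assms(1) isset_ext isset_singleton that)
      moreover have "oprod A (ext y) \<union> oprod A {z} = oprod A (insert z (ext y))"
        by (auto simp: oprod_def)
      ultimately show ?thesis by (simp add: ext_code isset_insert)
    qed
  qed
  then show ?thesis by (simp add: ext_code assms(2))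
qed

lemma no_mem_cycle: "E x y \<Longrightarrow> \<not> E y x"
  using foundation_set[of "{x, y}"] by (metis insertCI insertE insert_not_empty isset_pair singletonD)

lemma succ_inject [simp]: "succ x = succ y \<longleftrightarrow> x = y"
  using mem_succ[of x x] mem_succ[of y y] mem_succ[of x y] mem_succ[of y x] no_mem_cycle by metis

text \<open>From an injection of \<open>\<omega>\<close> into \<open>n + 1\<close> one obtains an injection into \<open>n\<close>: drop the value at
  \<open>0\<close>, and reuse it in place of \<open>n\<close> if \<open>n\<close> is among the remaining values.\<close>

lemma not_bounded_omega: "\<not> bounded omega"
proof -
  have "\<not> embeds omega (ext n)" if "n \<in> omega" for n
    using that
  proof (rule omega_induct)
    show "definable (\<lambda>s. \<not> embeds omega (ext (s 0)))"
      by (intro definable_intros isset_omega definable_isset[OF isset_omega])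
    show "\<not> embeds omega (ext zero)"
      using zero_in_omega unfolding embeds_def ext_zero by blast
  next
    fix n assume IH: "\<not> embeds omega (ext n)"
    show "\<not> embeds omega (ext (succ n))"
    proof
      assume "embeds omega (ext (succ n))"
      then obtain F where F: "definable_fun F" "inj_on F omega" "F ` omega \<subseteq> insert n (ext n)"
        by (auto simp: embeds_def)
      have inj: "F i = F j \<longleftrightarrow> i = j" if "i \<in> omega" "j \<in> omega" for i j
        using F(2) that by (auto dest: inj_onD)
      have into: "F i = n \<or> E (F i) n" if "i \<in> omega" for i
        using F(3) that by auto
      \<comment> \<open>If \<open>n\<close> is a value at a successor, then \<open>F zero\<close> is different from \<open>n\<close>.\<close>
      define G where "G i = (if F (succ i) = n then F zero else F (succ i))" for i
      have "embeds omega (ext n)"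
      proof (rule embedsI)
        show "definable_fun G"
          unfolding G_def by (intro definable_intros definable_term_subst1[OF F(1)])
        show "inj_on G omega"
        proof (rule inj_onI)
          fix i j assume "i \<in> omega" "j \<in> omega" "G i = G j"
          then show "i = j"
            using inj[of "succ i" "succ j"] inj[of zero "succ i"] inj[of zero "succ j"]
              succ_in_omega zero_in_omega by (simp add: G_def split: if_splits)
        qed
        show "G ` omega \<subseteq> ext n"
        proof (rule image_subsetI)
          fix i assume i: "i \<in> omega"
          then show "G i \<in> ext n"
            using into[OF succ_in_omega[OF i]] into[OF zero_in_omega]
              inj[OF succ_in_omega[OF i] zero_in_omega] by (auto simp: G_def)
        qed
      qed
      then show False using IH by blast
    qed
  qed
  then show ?thesis by (auto simp: bounded_def)
qed

lemma omega_subset_ordinal: "ordinal x \<Longrightarrow> x \<notin> omega \<Longrightarrow> omega \<subseteq> ext x"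
  using ordinal_subset_or_mem[OF ordinal_omega, of x] mem_code[OF isset_omega]
  by (simp add: ext_code)

section \<open>Products of infinite ordinals\<close>

text \<open>An injection of any ordinal that contains \<open>\<omega>\<close> into itself that misses \<open>0\<close>.\<close>

definition shift :: "'a \<Rightarrow> 'a" where
  "shift x = (if x \<in> omega then succ x else x)"

lemma definable_term_shift [definable_intros]:
  "definable_term t \<Longrightarrow> definable_term (\<lambda>s. shift (t s))"
  by (rule definable_term_subst1[of shift], unfold shift_def)
    (intro definable_intros definable_isset[OF isset_omega])

lemma shift_inject [simp]: "shift x = shift y \<longleftrightarrow> x = y"
  using succ_in_omega by (auto simp: shift_def)

lemma shift_neq_zero [simp]: "shift x \<noteq> zero"
  by (auto simp: shift_def)

lemma shift_mem: "omega \<subseteq> ext a \<Longrightarrow> E x a \<Longrightarrow> E (shift x) a"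
  using subsetD[of omega "ext a" "succ x"] succ_in_omega by (auto simp: shift_def)

lemma embeds_succ:
  assumes "omega \<subseteq> ext a"
  shows "embeds (ext (succ a)) (ext a)"
proof (rule embedsI)
  show "definable_fun (\<lambda>x. if x = a then zero else shift x)"
    by (intro definable_intros)
  show "inj_on (\<lambda>x. if x = a then zero else shift x) (ext (succ a))"
    by (auto simp: inj_on_def split: if_splits) (metis shift_neq_zero)+
  show "(\<lambda>x. if x = a then zero else shift x) ` ext (succ a) \<subseteq> ext a"
    using shift_mem[OF assms] subsetD[OF assms zero_in_omega] by auto
qed

definition max_coord :: "'a \<Rightarrow> 'a" where
  "max_coord p = (if E (ofst p) (osnd p) then osnd p else ofst p)"

text \<open>Comparing the maxima first ensures that the predecessors of a pair with maximum \<open>m\<close> lie in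
  \<open>(m + 1) \<times> (m + 1)\<close>.\<close>

definition goedel_less :: "'a \<Rightarrow> 'a \<Rightarrow> bool" where
  "goedel_less p q \<longleftrightarrow> E (max_coord p) (max_coord q) \<or> max_coord p = max_coord q \<and>
    (E (ofst p) (ofst q) \<or> ofst p = ofst q \<and> E (osnd p) (osnd q))"

lemma definable_term_max_coord [definable_intros]:
  "definable_term t \<Longrightarrow> definable_term (\<lambda>s. max_coord (t s))"
  by (rule definable_term_subst1[of max_coord], unfold max_coord_def) (intro definable_intros)

lemma minimal_image:
  assumes "isset B" "B \<noteq> {}" "definable_fun F"
  obtains p where "p \<in> B" "\<And>q. q \<in> B \<Longrightarrow> \<not> E (F q) (F p)"
proof -
  obtain y where "y \<in> F ` B" "\<And>z. E z y \<Longrightarrow> z \<notin> F ` B"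
    using foundation_set[OF isset_image[OF assms(1,3)]] assms(2) by blast
  then show ?thesis using that by blast
qed

lemma internal_wellorder_goedel:
  assumes k: "ordinal k"
  shows "internal_wellorder E (oprod (ext k) (ext k)) goedel_less"
proof
  let ?A = "oprod (ext k) (ext k)"
  show "isset ?A" by (intro isset_oprod isset_ext)
  show "definable (\<lambda>s. goedel_less (s 0) (s (Suc 0)))"
    unfolding goedel_less_def by (intro definable_intros)
  have ord: "ordinal (ofst p)" "ordinal (osnd p)" "ordinal (max_coord p)" if "p \<in> ?A" for p
    using that ordinal_mem[OF k] by (auto simp: oprod_def max_coord_def)
  show "\<not> goedel_less p p" for p by (simp add: goedel_less_def)
  show "goedel_less p r" if "r \<in> ?A" "goedel_less p q" "goedel_less q r" for p q r
    using that(2,3) ordinal_trans[OF ord(1)[OF that(1)], of "ofst q" "ofst p"]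
      ordinal_trans[OF ord(2)[OF that(1)], of "osnd q" "osnd p"]
      ordinal_trans[OF ord(3)[OF that(1)], of "max_coord q" "max_coord p"]
    unfolding goedel_less_def by auto
  show "goedel_less p q \<or> p = q \<or> goedel_less q p" if "p \<in> ?A" "q \<in> ?A" for p q
  proof -
    have "p = opair (ofst p) (osnd p)" "q = opair (ofst q) (osnd q)"
      using that by (auto simp: oprod_def)
    then have "p = q" if "ofst p = ofst q" "osnd p = osnd q" using that by metis
    then show ?thesis
      using ordinal_linear[OF ord(1)[OF that(1)] ord(1)[OF that(2)]]
        ordinal_linear[OF ord(2)[OF that(1)] ord(2)[OF that(2)]]
        ordinal_linear[OF ord(3)[OF that(1)] ord(3)[OF that(2)]]
      unfolding goedel_less_def by auto
  qed
  show "\<exists>p\<in>B. \<forall>q\<in>B. \<not> goedel_less q p" if B: "isset B" "B \<noteq> {}" for B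
  proof -
    \<comment> \<open>Minimise the maximum, then the first and then the second coordinate.\<close>
    obtain a where a: "a \<in> B" "\<And>q. q \<in> B \<Longrightarrow> \<not> E (max_coord q) (max_coord a)"
      by (rule minimal_image[OF B, of max_coord]) (auto intro: definable_intros)
    define B1 where "B1 = {q \<in> B. max_coord q = max_coord a}"
    have B1: "isset B1" "B1 \<noteq> {}"
      using a(1) unfolding B1_def by (auto intro!: isset_sep B definable_intros)
    obtain b where b: "b \<in> B1" "\<And>q. q \<in> B1 \<Longrightarrow> \<not> E (ofst q) (ofst b)"
      by (rule minimal_image[OF B1, of ofst]) (auto intro: definable_intros)
    define B2 where "B2 = {q \<in> B1. ofst q = ofst b}"
    have B2: "isset B2" "B2 \<noteq> {}"
      using b(1) unfolding B2_def by (auto intro!: isset_sep B1 definable_intros)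
    obtain c where c: "c \<in> B2" "\<And>q. q \<in> B2 \<Longrightarrow> \<not> E (osnd q) (osnd c)"
      by (rule minimal_image[OF B2, of osnd]) (auto intro: definable_intros)
    have "\<not> goedel_less q c" if "q \<in> B" for q
      using that a(2) b(2) c by (auto simp: goedel_less_def B1_def B2_def)
    moreover have "c \<in> B" using c(1) by (simp add: B1_def B2_def)
    ultimately show ?thesis by blast
  qed
qed

text \<open>By induction, it suffices to treat \<open>k\<close> that does not inject into any of its elements. Let
  \<open>c\<close> be the collapse of \<open>k \<times> k\<close> under Goedel's order. If \<open>k \<in> c\<close>, then \<open>k\<close> is equinumerous
  to the predecessors of a pair and so injects into \<open>(m + 1) \<times> (m + 1)\<close> for some \<open>m \<in> k\<close>. For
  \<open>m \<in> \<omega>\<close> this product is finite; otherwise the induction hypothesis injects it into \<open>m\<close>.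
  Both are impossible, so \<open>c \<subseteq> k\<close>.\<close>

lemma hessenberg:
  assumes "ordinal k" "k \<notin> omega"
  shows "embeds (oprod (ext k) (ext k)) (ext k)"
proof -
  have "k \<notin> omega \<longrightarrow> embeds (oprod (ext k) (ext k)) (ext k)"
    using assms(1)
  proof (rule ordinal_induct)
    show "definable (\<lambda>s. s 0 \<notin> omega \<longrightarrow> embeds (oprod (ext (s 0)) (ext (s 0))) (ext (s 0)))"
      by (intro definable_intros isset_oprod isset_ext definable_isset[OF isset_omega])
  next
    fix k assume k: "ordinal k"
      and IH: "\<And>d. E d k \<Longrightarrow> d \<notin> omega \<longrightarrow> embeds (oprod (ext d) (ext d)) (ext d)"
    show "k \<notin> omega \<longrightarrow> embeds (oprod (ext k) (ext k)) (ext k)"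
    proof
      assume "k \<notin> omega"
      then have unbounded: "\<not> bounded (ext k)"
        using omega_subset_ordinal[OF k] bounded_embeds[OF embeds_subset] not_bounded_omega by blast
      show "embeds (oprod (ext k) (ext k)) (ext k)"
      proof (cases "\<exists>d. E d k \<and> embeds (ext k) (ext d)")
        case True
        then obtain d where d: "E d k" "embeds (ext k) (ext d)" by blast
        then have "d \<notin> omega" using unbounded by (auto simp: bounded_def)
        with d show ?thesis
          using IH embeds_trans[OF embeds_oprod] embeds_trans embeds_subset[OF ordinal_subset[OF k d(1)]]
          by blast
      next
        case False
        interpret internal_wellorder E "oprod (ext k) (ext k)" goedel_less
          by (rule internal_wellorder_goedel[OF k])
        obtain C c where C: "definable_fun C" "ordinal c" "bij_betw C (oprod (ext k) (ext k)) (ext c)"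
          "\<And>a. a \<in> oprod (ext k) (ext k) \<Longrightarrow>
            ext (C a) = C ` {b \<in> oprod (ext k) (ext k). goedel_less b a}"
          by (rule collapse) (rule that)
        have "\<not> E k c"
        proof
          assume "E k c"
          then have "k \<in> C ` oprod (ext k) (ext k)" using bij_betw_imp_surj_on[OF C(3)] by simp
          then obtain p where p: "p \<in> oprod (ext k) (ext k)" "k = C p" by blast
          define m where "m = max_coord p"
          define P where "P = {q \<in> oprod (ext k) (ext k). goedel_less q p}"
          have "E m k" using p(1) by (auto simp: m_def max_coord_def oprod_def)
          have "P \<subseteq> oprod (ext (succ m)) (ext (succ m))"
          proof
            fix q assume "q \<in> P"
            then obtain x y where q: "q = opair x y" "E x k" "E y k" "goedel_less q p"
              by (auto simp: P_def oprod_def)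
            have le: "E x (max_coord q) \<or> x = max_coord q" "E y (max_coord q) \<or> y = max_coord q"
              using ordinal_linear[OF ordinal_mem[OF k q(2)] ordinal_mem[OF k q(3)]] q(1)
              by (auto simp: max_coord_def)
            have "E (max_coord q) m \<or> max_coord q = m"
              using q(4) by (auto simp: goedel_less_def m_def)
            then have "E x (succ m)" "E y (succ m)"
              using le ordinal_trans[OF ordinal_mem[OF k \<open>E m k\<close>], of "max_coord q"]
              unfolding mem_succ by blast+
            then show "q \<in> oprod (ext (succ m)) (ext (succ m))"
              unfolding q(1) oprod_def by (simp only: mem_ext mem_Collect_eq) blast
          qed
          moreover have "ext k = C ` P" using C(4)[OF p(1)] p(2) by (simp add: P_def)
          moreover have "embeds (C ` P) P"
            unfolding P_def using bij_betw_imp_inj_on[OF C(3)]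
            by (intro embeds_inverse isset_predecessors C(1)) (auto intro: inj_on_subset)
          ultimately have k_succ: "embeds (ext k) (oprod (ext (succ m)) (ext (succ m)))"
            using embeds_trans embeds_subset by metis
          show False
          proof (cases "m \<in> omega")
            case True
            then have "bounded (ext (succ m))"
              unfolding bounded_def using succ_in_omega embeds_subset[OF subset_refl] by blast
            then have "bounded (oprod (ext (succ m)) (ext (succ m)))"
              by (intro bounded_oprod isset_ext)
            then show False using unbounded bounded_embeds[OF k_succ] by blast
          next
            case infinite: False
            have "embeds (ext (succ m)) (ext m)"
              using omega_subset_ordinal[OF ordinal_mem[OF k \<open>E m k\<close>] infinite] by (rule embeds_succ)
            then have "embeds (ext k) (ext m)"
              using embeds_trans[OF k_succ] embeds_oprod embeds_trans IH[OF \<open>E m k\<close>] infinite by blast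
            then show False using False \<open>E m k\<close> by blast
          qed
        qed
        then have "ext c \<subseteq> ext k" using ordinal_subset_or_mem[OF C(2) k] by blast
        then show ?thesis
          using C(3) by (intro embedsI[OF C(1)]) (auto simp: bij_betw_def)
      qed
    qed
  qed
  then show ?thesis using assms(2) by blast
qed

section \<open>From choice to the cardinal equations\<close>

lemma embeds_two_subsets:
  assumes "isset A" "embeds A B"
  shows "embeds (two_subsets A) (two_subsets B)"
proof -
  obtain F where F: "definable_fun F" "inj_on F A" "F ` A \<subseteq> B"
    using assms(2) by (auto simp: embeds_def)
  have image: "code (F ` ext (upair a b)) = upair (F a) (F b)" for a b
    by (simp add: upair_def[symmetric])
  have eq: "F a = F b \<longleftrightarrow> a = b" if "a \<in> A" "b \<in> A" for a b
    using F(2) that by (auto dest: inj_onD)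
  show ?thesis
  proof (rule embedsI)
    show "definable_fun (\<lambda>p. code (F ` ext p))"
      by (intro definable_intros definable_term_subst1[OF F(1)])
    show "inj_on (\<lambda>p. code (F ` ext p)) (two_subsets A)"
    proof (rule inj_onI)
      fix p q assume "p \<in> two_subsets A" "q \<in> two_subsets A" "code (F ` ext p) = code (F ` ext q)"
      then obtain a b c d where "p = upair a b" "q = upair c d"
        "a \<in> A" "b \<in> A" "c \<in> A" "d \<in> A" "upair (F a) (F b) = upair (F c) (F d)"
        unfolding two_subsets_def using image by auto
      then show "p = q" by (auto simp: upair_eq_iff doubleton_eq_iff eq)
    qed
    show "(\<lambda>p. code (F ` ext p)) ` two_subsets A \<subseteq> two_subsets B"
    proof (rule image_subsetI)
      fix p assume "p \<in> two_subsets A"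
      then obtain a b where ab: "p = upair a b" "a \<in> A" "b \<in> A" "a \<noteq> b"
        by (auto simp: two_subsets_def)
      then have "F a \<in> B" "F b \<in> B" "F a \<noteq> F b" using F(3) eq by auto
      then show "code (F ` ext p) \<in> two_subsets B"
        unfolding ab(1) image two_subsets_def by blast
    qed
  qed
qed

text \<open>A two-element set of ordinals is listed in increasing order; the order of the two entries is
  unambiguous because \<open>\<in>\<close> has no cycles.\<close>

lemma embeds_two_subsets_oprod:
  assumes "ordinal k"
  shows "embeds (two_subsets (ext k)) (oprod (ext k) (ext k))"
proof -
  define G where "G p = the1 (\<lambda>q. \<exists>u v. E u v \<and> p = upair u v \<and> q = opair u v)" for p
  have G: "G (upair u v) = opair u v" if "E u v" for u v
    unfolding G_def using that no_mem_cycle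
    by (intro the1_eqI) (auto simp: upair_eq_iff doubleton_eq_iff)
  have cases: "\<exists>u v. p = upair u v \<and> E u v \<and> E u k \<and> E v k" if p: "p \<in> two_subsets (ext k)" for p
  proof -
    obtain a b where ab: "p = upair a b" "E a k" "E b k" "a \<noteq> b"
      using p by (auto simp: two_subsets_def)
    moreover have "upair a b = upair b a" by (simp add: upair_eq_iff insert_commute)
    ultimately show ?thesis
      using ordinal_linear[OF ordinal_mem[OF assms ab(2)] ordinal_mem[OF assms ab(3)]] by metis
  qed
  show ?thesis
  proof (rule embedsI)
    show "definable_fun G" unfolding G_def by (intro definable_intros)
    show "inj_on G (two_subsets (ext k))"
    proof (rule inj_onI)
      fix p q assume pq: "p \<in> two_subsets (ext k)" "q \<in> two_subsets (ext k)" "G p = G q"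
      obtain u v x y where "p = upair u v" "E u v" "q = upair x y" "E x y"
        using cases[OF pq(1)] cases[OF pq(2)] by blast
      then show "p = q" using G[of u v] G[of x y] pq(3) by simp
    qed
    show "G ` two_subsets (ext k) \<subseteq> oprod (ext k) (ext k)"
    proof (rule image_subsetI)
      fix p assume "p \<in> two_subsets (ext k)"
      from cases[OF this] show "G p \<in> oprod (ext k) (ext k)"
        using G unfolding oprod_def by auto
    qed
  qed
qed

text \<open>The map sends \<open>x\<close> to \<open>{0, x'}\<close>, where \<open>x'\<close> runs injectively through nonzero elements.\<close>

lemma embeds_into_two_subsets:
  assumes "omega \<subseteq> ext k"
  shows "embeds (ext k) (two_subsets (ext k))"
proof (rule embedsI)
  show "definable_fun (\<lambda>x. upair zero (shift x))" by (intro definable_intros)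
  show "inj_on (\<lambda>x. upair zero (shift x)) (ext k)"
    by (auto simp: inj_on_def upair_eq_iff doubleton_eq_iff)
  show "(\<lambda>x. upair zero (shift x)) ` ext k \<subseteq> two_subsets (ext k)"
  proof (rule image_subsetI)
    fix x assume "x \<in> ext k"
    then have "shift x \<in> ext k" "zero \<in> ext k"
      using shift_mem[OF assms] subsetD[OF assms zero_in_omega] by auto
    then show "upair zero (shift x) \<in> two_subsets (ext k)"
      unfolding two_subsets_def using shift_neq_zero[of x, symmetric] by blast
  qed
qed

theorem equinumerous_two_subsets_if_choice:
  assumes "axiom_of_choice E" "\<And>n. n \<in> omega \<Longrightarrow> \<not> equinumerous E m n"
    "ext p = two_subsets (ext m)"
  shows "equinumerous E p m"
proof -
  obtain x where x: "ordinal x" "embeds (ext m) (ext x)"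
    using embeds_ordinal_if_choice[OF assms(1)] by blast
  obtain k F where k: "ordinal k" "definable_fun F" "bij_betw F (ext m) (ext k)"
    by (rule bij_least_ordinal[OF isset_ext x])
  then have mk: "equinumerous E m k" by (auto simp: equinumerous_iff)
  then have "k \<notin> omega" using assms(2) by blast
  have m_k: "embeds (ext m) (ext k)" and k_m: "embeds (ext k) (ext m)"
    using embeds_if_equinumerous mk equinumerous_sym by blast+
  have p_k: "embeds (ext p) (ext k)"
    unfolding assms(3)
    using embeds_trans[OF embeds_two_subsets[OF isset_ext m_k]]
      embeds_trans[OF embeds_two_subsets_oprod[OF k(1)] hessenberg[OF k(1) \<open>k \<notin> omega\<close>]] by blast
  have "embeds (ext k) (ext p)"
    unfolding assms(3)
    using embeds_trans[OF embeds_into_two_subsets embeds_two_subsets[OF isset_ext k_m]]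
      omega_subset_ordinal[OF k(1) \<open>k \<notin> omega\<close>] by blast
  then show ?thesis
    using equinumerous_if_embeds[OF embeds_trans[OF p_k k_m] embeds_trans[OF m_k] k(1) p_k] by blast
qed

lemma cardinality_eq: "equinumerous E x y \<Longrightarrow> cardinality E x = cardinality E y"
  unfolding cardinality_def using equinumerous_trans equinumerous_sym by blast

theorem two_subsets_cardinal_if_choice:
  assumes "axiom_of_choice E" "infinite_cardinal E \<mm>"
  shows "two_subsets_cardinal E \<mm> = \<mm>"
proof -
  have single: "cardinality E p = \<mm>" if m: "m \<in> \<mm>" and p: "is_two_subsets E m p" for m p
  proof -
    have m': "\<mm> = cardinality E m"
      using assms(2) m cardinality_eq
      unfolding infinite_cardinal_def is_cardinal_def by (auto simp: cardinality_def)
    have "\<not> equinumerous E m n" if "n \<in> omega" for n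
      using assms(2) that cardinality_eq unfolding infinite_cardinal_def m' omega_def by blast
    then have "equinumerous E p m"
      using equinumerous_two_subsets_if_choice[OF assms(1)] p unfolding is_two_subsets_iff by blast
    then show ?thesis unfolding m' by (rule cardinality_eq)
  qed
  obtain m where m: "m \<in> \<mm>"
    using assms(2) equinumerous_refl
    unfolding infinite_cardinal_def is_cardinal_def cardinality_def by blast
  obtain p where p: "is_two_subsets E m p"
    unfolding is_two_subsets_iff using isset_two_subsets[OF isset_ext] by (auto simp: isset_def)
  have "{cardinality E p | m p. m \<in> \<mm> \<and> is_two_subsets E m p} = {\<mm>}"
  proof (intro equalityI subsetI)
    show "C \<in> {\<mm>}" if "C \<in> {cardinality E p | m p. m \<in> \<mm> \<and> is_two_subsets E m p}" for C
      using that single by auto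
    show "C \<in> {cardinality E p | m p. m \<in> \<mm> \<and> is_two_subsets E m p}" if "C \<in> {\<mm>}" for C
      using that single[OF m p] m p by auto
  qed
  then show ?thesis by (simp add: two_subsets_cardinal_def)
qed

end

text \<open>The first condition trivially implies the second, so it suffices that choice implies the first
  and that the second implies choice.\<close>

theorem proposition4p2:
  fixes E :: "'a \<Rightarrow> 'a \<Rightarrow> bool"
  assumes "ZF_model E"
  shows "(axiom_of_choice E \<longleftrightarrow>
            (\<forall>\<mm>. infinite_cardinal E \<mm> \<longrightarrow> two_subsets_cardinal E \<mm> = \<mm>)) \<and>
         (axiom_of_choice E \<longleftrightarrow>
            (\<forall>\<mm>. infinite_cardinal E \<mm> \<longrightarrow>
               two_subsets_cardinal E \<mm> = \<mm> \<or> cardinal_mult E \<mm> \<mm> = \<mm>))"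
proof -
  interpret ZF_model E by (rule assms)
  show ?thesis
    using two_subsets_cardinal_if_choice choice_if_two_subsets_or_square by blast
qed

end
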